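(* Let $(k^{(p)})_{p\ge1}$ be a sequence of kernels ($k=k^{(p)}$ on $\mathbb{R}^p$) with $\mathbb{E}[k^4(Z_1,Z_2)]<\infty$ for each $p$, and suppose $n/N\to\rho$ as $n,m\to\infty$ for some $0<\rho<1$, where $N=n+m$. Assume the null hypothesis $X=^dY$ (so $X=^dY=^dZ$). If for some constant $0<\tau\le1$, $$\frac{\mathbb{E}\big[|\tilde k(Z_1,Z_2)|^{2+2\tau}\big]}{N^\tau(\mathcal{V}_k^2(Z))^{1+\tau}}\to0\quad\text{as }N,p\to\infty,$$ then $\mathcal{V}_{n,m}^{k*}(X,Y)/\mathcal{V}_k^2(Z)\to1$ in probability. Consequently, under the null, $c_{n,m}\mathcal{V}_{n,m}^{k*}(X,Y)/\mathrm{Var}(L_{n,m}^k(X,Y))\to1$ in probability.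
   Context: Kernel: a kernel on $\mathbb{R}^p$ is a symmetric function $k:\mathbb{R}^p\times\mathbb{R}^p\to\mathbb{R}$ satisfying either (a) $k\ge0$, $k(x,y)=0$ iff $x=y$, and for all Borel probability measures $P\ne Q$ with $\int k(z,z_0)\,dP(z)<\infty$ and $\int k(z,z_0)\,dQ(z)<\infty$ for some $z_0$, one has $\int k\,d([P-Q]\times[P-Q])<0$; or (b) $-k$ is the reproducing kernel of an RKHS on $\mathbb{R}^p$ and is characteristic (the mean embedding map on Borel probability measures is injective). It is assumed that $k(x,x)=a_0^k$ is a finite constant not depending on $x$. Sampling: for each $p$, $X,Y$ are random vectors in $\mathbb{R}^p$; $X_1,\dots,X_n$ are i.i.d. copies of $X$, $Y_1,\dots,Y_m$ are i.i.d. copies of $Y$, the two samples are independent. $Z$ equals $X$ with probability $\rho$ and $Y$ with probability $1-\rho$; $Z_1,Z_2,\dots$ are i.i.d. copies of $Z$. Notation: $\tilde k(Z_1,Z_2)=k(Z_1,Z_2)-\mathbb{E}[k(Z_1,Z_2)]$; $\mathcal{V}_k^2(Z)=\mathbb{E}[k^2(Z_1,Z_2)]-2\mathbb{E}[k(Z_1,Z_2)k(Z_1,Z_3)]+(\mathbb{E}[k(Z_1,Z_2)])^2$; $c_{n,m}=\frac{2}{n(n-1)}+\frac{4}{nm}+\frac{2}{m(m-1)}$. $L_{n,m}^k(X,Y)$: with $h^k(x_1,x_2,y_1,y_2)=\frac12\sum_{i,j=1}^2k(x_i,y_j)-k(x_1,x_2)-k(y_1,y_2)$, $h_{20}(x_1,x_2)=\mathbb{E}[h^k(x_1,x_2,Y_1,Y_2)]$,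 $h_{02}(y_1,y_2)=\mathbb{E}[h^k(X_1,X_2,y_1,y_2)]$, $h_{11}(x,y)=\mathbb{E}[h^k(x,X_2,y,Y_2)]$, under the null $L_{n,m}^k(X,Y)=\binom n2^{-1}\sum_{i_1<i_2}h_{20}(X_{i_1},X_{i_2})+\frac{4}{nm}\sum_{i=1}^n\sum_{j=1}^mh_{11}(X_i,Y_j)+\binom m2^{-1}\sum_{j_1<j_2}h_{02}(Y_{j_1},Y_{j_2})$. Variance estimator: let $W_1,\dots,W_N$ be the pooled sample ($W_s=X_s$ for $s\le n$, $W_s=Y_{s-n}$ for $s>n$), $a_{s,t}=k(W_s,W_t)$ for $1\le s,t\le N$, $\tilde a_{\cdot t}=\frac{1}{N-2}\sum_{i=1}^N a_{i,t}$, $\tilde a_{s\cdot}=\frac1{N-2}\sum_{j=1}^Na_{s,j}$, $\tilde a_{\cdot\cdot}=\frac{1}{(N-1)(N-2)}\sum_{i,j=1}^Na_{i,j}$, $A^*_{s,t}=a_{s,t}-\tilde a_{\cdot t}-\tilde a_{s\cdot}+\tilde a_{\cdot\cdot}$, and $\mathcal{V}_{n,m}^{k*}(X,Y)=\frac{1}{N(N-3)}\sum_{s\ne t}(A^*_{s,t})^2-\frac{(a_0^k)^2}{(N-1)(N-3)}$. *)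

theory Defs
  imports "HOL-Probability.Probability"
begin

text \<open>Points of \<open>p\<close>-dimensional space are the extensional functions on \<open>{1..p}\<close>, so that the
  dimension can vary along a sequence. The product of the \<open>p\<close> Borel sigma-algebras is the
  Borel sigma-algebra of \<open>p\<close>-dimensional Euclidean space.\<close>

type_synonym point = "nat \<Rightarrow> real"

definition Rp :: "nat \<Rightarrow> point measure" where
  "Rp p = PiM {1..p} (\<lambda>_. borel)"

definition borel_probs :: "nat \<Rightarrow> point measure set" where
  "borel_probs p = {P. prob_space P \<and> sets P = sets (Rp p)}"


text \<open>A function with domain \<open>S\<close> is represented by its extension by \<open>0\<close>; then
  the vector space operations are the pointwise ones.\<close>

definition zero_ext :: "'x set \<Rightarrow> ('x \<Rightarrow> real) \<Rightarrow> 'x \<Rightarrow> real" where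
  "zero_ext S f = (\<lambda>x. if x \<in> S then f x else 0)"

definition hilbert_function_space ::
  "'x set \<Rightarrow> ('x \<Rightarrow> real) set \<Rightarrow> (('x \<Rightarrow> real) \<Rightarrow> ('x \<Rightarrow> real) \<Rightarrow> real) \<Rightarrow> bool" where
  "hilbert_function_space S H ip \<longleftrightarrow>
     (\<forall>f\<in>H. \<forall>x. x \<notin> S \<longrightarrow> f x = 0) \<and>
     (\<lambda>_. 0) \<in> H \<and>
     (\<forall>f\<in>H. \<forall>g\<in>H. (\<lambda>x. f x + g x) \<in> H) \<and>
     (\<forall>c. \<forall>f\<in>H. (\<lambda>x. c * f x) \<in> H) \<and>
     (\<forall>f\<in>H. \<forall>g\<in>H. ip f g = ip g f) \<and>
     (\<forall>f\<in>H. \<forall>g\<in>H. \<forall>h\<in>H. ip (\<lambda>x. f x + g x) h = ip f h + ip g h) \<and>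
     (\<forall>c. \<forall>f\<in>H. \<forall>h\<in>H. ip (\<lambda>x. c * f x) h = c * ip f h) \<and>
     (\<forall>f\<in>H. 0 \<le> ip f f) \<and>
     (\<forall>f\<in>H. ip f f = 0 \<longrightarrow> f = (\<lambda>_. 0)) \<and>
     (\<forall>F :: nat \<Rightarrow> 'x \<Rightarrow> real. (\<forall>i. F i \<in> H) \<and>
        (\<forall>e>0. \<exists>i0. \<forall>i\<ge>i0. \<forall>j\<ge>i0. ip (\<lambda>x. F i x - F j x) (\<lambda>x. F i x - F j x) < e) \<longrightarrow>
        (\<exists>f\<in>H. (\<lambda>i. ip (\<lambda>x. F i x - f x) (\<lambda>x. F i x - f x)) \<longlonglongrightarrow> 0))"

definition reproducing_kernel_of ::
  "'x set \<Rightarrow> ('x \<Rightarrow> real) set \<Rightarrow> (('x \<Rightarrow> real) \<Rightarrow> ('x \<Rightarrow> real) \<Rightarrow> real) \<Rightarrow> ('x \<Rightarrow> 'x \<Rightarrow> real) \<Rightarrow> bool"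
where
  "reproducing_kernel_of S H ip K \<longleftrightarrow>
     hilbert_function_space S H ip \<and>
     (\<forall>x\<in>S. zero_ext S (K x) \<in> H \<and> (\<forall>f\<in>H. ip f (zero_ext S (K x)) = f x))"

text \<open>The mean embedding of \<open>P\<close> is the Riesz representer of \<open>f \<mapsto> \<integral>f dP\<close>. It exists and is unique
  for every Borel probability measure when the kernel is measurable with bounded diagonal,
  since then all elements of \<open>H\<close> are bounded and measurable.\<close>

definition mean_embedding ::
  "('x \<Rightarrow> real) set \<Rightarrow> (('x \<Rightarrow> real) \<Rightarrow> ('x \<Rightarrow> real) \<Rightarrow> real) \<Rightarrow> 'x measure \<Rightarrow> ('x \<Rightarrow> real)" where
  "mean_embedding H ip P = (THE \<mu>. \<mu> \<in> H \<and> (\<forall>f\<in>H. ip f \<mu> = (\<integral>x. f x \<partial>P)))"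

definition characteristic_rkhs_kernel :: "nat \<Rightarrow> (point \<Rightarrow> point \<Rightarrow> real) \<Rightarrow> bool" where
  "characteristic_rkhs_kernel p K \<longleftrightarrow>
     (\<exists>H ip. reproducing_kernel_of (space (Rp p)) H ip K \<and>
             inj_on (mean_embedding H ip) (borel_probs p))"


text \<open>The integral of \<open>k\<close> against the signed measure \<open>(P - Q) \<times> (P - Q)\<close>.\<close>

definition signed_energy :: "(point \<Rightarrow> point \<Rightarrow> real) \<Rightarrow> point measure \<Rightarrow> point measure \<Rightarrow> real" where
  "signed_energy k P Q =
     (\<integral>z. case_prod k z \<partial>(P \<Otimes>\<^sub>M P)) - (\<integral>z. case_prod k z \<partial>(P \<Otimes>\<^sub>M Q))
     - (\<integral>z. case_prod k z \<partial>(Q \<Otimes>\<^sub>M P)) + (\<integral>z. case_prod k z \<partial>(Q \<Otimes>\<^sub>M Q))"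

text \<open>No integrability of \<open>k\<close> for the four product measures needs to be required: finitely
  supported \<open>P\<close>, \<open>Q\<close> show that \<open>k\<close> is of negative type, so its square root is a metric and
  \<open>k x y \<le> 2 * (k x z0 + k y z0)\<close>.\<close>

definition strong_negative_type_kernel :: "nat \<Rightarrow> (point \<Rightarrow> point \<Rightarrow> real) \<Rightarrow> bool" where
  "strong_negative_type_kernel p k \<longleftrightarrow>
     (\<forall>x\<in>space (Rp p). \<forall>y\<in>space (Rp p). 0 \<le> k x y \<and> (k x y = 0 \<longleftrightarrow> x = y)) \<and>
     (\<forall>P\<in>borel_probs p. \<forall>Q\<in>borel_probs p.
        P \<noteq> Q \<and>
        (\<exists>z0\<in>space (Rp p). integrable P (\<lambda>z. k z z0) \<and> integrable Q (\<lambda>z. k z z0)) \<longrightarrow>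
        signed_energy k P Q < 0)"

definition is_kernel :: "nat \<Rightarrow> (point \<Rightarrow> point \<Rightarrow> real) \<Rightarrow> bool" where
  "is_kernel p k \<longleftrightarrow>
     case_prod k \<in> borel_measurable (Rp p \<Otimes>\<^sub>M Rp p) \<and>
     (\<forall>x\<in>space (Rp p). \<forall>y\<in>space (Rp p). k x y = k y x) \<and>
     (strong_negative_type_kernel p k \<or> characteristic_rkhs_kernel p (\<lambda>x y. - k x y))"


text \<open>Samples are indexed from \<open>1\<close>.\<close>

definition iid_copies :: "'a measure \<Rightarrow> 'b measure \<Rightarrow> ('a \<Rightarrow> 'b) \<Rightarrow> (nat \<Rightarrow> 'a \<Rightarrow> 'b) \<Rightarrow> bool" where
  "iid_copies M S U Us \<longleftrightarrow>
     prob_space.indep_vars M (\<lambda>_. S) Us {1..} \<and>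
     (\<forall>i\<ge>1. distr M S (Us i) = distr M S U)"

definition independent_samples ::
  "'a measure \<Rightarrow> 'b measure \<Rightarrow> ('a \<Rightarrow> 'b) \<Rightarrow> ('a \<Rightarrow> 'b) \<Rightarrow> (nat \<Rightarrow> 'a \<Rightarrow> 'b) \<Rightarrow> (nat \<Rightarrow> 'a \<Rightarrow> 'b) \<Rightarrow> bool"
where
  "independent_samples M S X Y Xs Ys \<longleftrightarrow>
     iid_copies M S X Xs \<and> iid_copies M S Y Ys \<and>
     prob_space.indep_vars M (\<lambda>_. S) (case_sum Xs Ys) ({1..} <+> {1..})"

definition mixture_of ::
  "'a measure \<Rightarrow> 'b measure \<Rightarrow> real \<Rightarrow> ('a \<Rightarrow> 'b) \<Rightarrow> ('a \<Rightarrow> 'b) \<Rightarrow> ('a \<Rightarrow> 'b) \<Rightarrow> bool" where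
  "mixture_of M S \<rho> X Y Z \<longleftrightarrow>
     (\<forall>A\<in>sets S. measure (distr M S Z) A =
        \<rho> * measure (distr M S X) A + (1 - \<rho>) * measure (distr M S Y) A)"


text \<open>Below, \<open>Z1\<close>, \<open>Z2\<close>, \<open>Z3\<close> are the values of a sequence \<open>Zs\<close> of copies of \<open>Z\<close>.\<close>

definition k_centered ::
  "'a measure \<Rightarrow> ('b \<Rightarrow> 'b \<Rightarrow> real) \<Rightarrow> (nat \<Rightarrow> 'a \<Rightarrow> 'b) \<Rightarrow> 'a \<Rightarrow> real" where
  "k_centered M k Zs \<omega> = k (Zs 1 \<omega>) (Zs 2 \<omega>) - (\<integral>\<omega>'. k (Zs 1 \<omega>') (Zs 2 \<omega>') \<partial>M)"

definition V2 :: "'a measure \<Rightarrow> ('b \<Rightarrow> 'b \<Rightarrow> real) \<Rightarrow> (nat \<Rightarrow> 'a \<Rightarrow> 'b) \<Rightarrow> real" where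
  "V2 M k Zs =
     (\<integral>\<omega>. (k (Zs 1 \<omega>) (Zs 2 \<omega>))\<^sup>2 \<partial>M)
     - 2 * (\<integral>\<omega>. k (Zs 1 \<omega>) (Zs 2 \<omega>) * k (Zs 1 \<omega>) (Zs 3 \<omega>) \<partial>M)
     + (\<integral>\<omega>. k (Zs 1 \<omega>) (Zs 2 \<omega>) \<partial>M)\<^sup>2"

definition c_coeff :: "nat \<Rightarrow> nat \<Rightarrow> real" where
  "c_coeff n m = 2 / (real n * (real n - 1)) + 4 / (real n * real m) + 2 / (real m * (real m - 1))"

definition h_core :: "('b \<Rightarrow> 'b \<Rightarrow> real) \<Rightarrow> 'b \<Rightarrow> 'b \<Rightarrow> 'b \<Rightarrow> 'b \<Rightarrow> real" where
  "h_core k x1 x2 y1 y2 =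
     1 / 2 * (k x1 y1 + k x1 y2 + k x2 y1 + k x2 y2) - k x1 x2 - k y1 y2"

definition h20 ::
  "'a measure \<Rightarrow> ('b \<Rightarrow> 'b \<Rightarrow> real) \<Rightarrow> (nat \<Rightarrow> 'a \<Rightarrow> 'b) \<Rightarrow> 'b \<Rightarrow> 'b \<Rightarrow> real" where
  "h20 M k Ys x1 x2 = (\<integral>\<omega>. h_core k x1 x2 (Ys 1 \<omega>) (Ys 2 \<omega>) \<partial>M)"

definition h02 ::
  "'a measure \<Rightarrow> ('b \<Rightarrow> 'b \<Rightarrow> real) \<Rightarrow> (nat \<Rightarrow> 'a \<Rightarrow> 'b) \<Rightarrow> 'b \<Rightarrow> 'b \<Rightarrow> real" where
  "h02 M k Xs y1 y2 = (\<integral>\<omega>. h_core k (Xs 1 \<omega>) (Xs 2 \<omega>) y1 y2 \<partial>M)"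

definition h11 ::
  "'a measure \<Rightarrow> ('b \<Rightarrow> 'b \<Rightarrow> real) \<Rightarrow> (nat \<Rightarrow> 'a \<Rightarrow> 'b) \<Rightarrow> (nat \<Rightarrow> 'a \<Rightarrow> 'b) \<Rightarrow> 'b \<Rightarrow> 'b \<Rightarrow> real" where
  "h11 M k Xs Ys x y = (\<integral>\<omega>. h_core k x (Xs 2 \<omega>) y (Ys 2 \<omega>) \<partial>M)"

definition L_stat ::
  "'a measure \<Rightarrow> ('b \<Rightarrow> 'b \<Rightarrow> real) \<Rightarrow> nat \<Rightarrow> nat \<Rightarrow> (nat \<Rightarrow> 'a \<Rightarrow> 'b) \<Rightarrow> (nat \<Rightarrow> 'a \<Rightarrow> 'b) \<Rightarrow> 'a \<Rightarrow> real"
where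
  "L_stat M k n m Xs Ys \<omega> =
     1 / real (n choose 2) * (\<Sum>i2=1..n. \<Sum>i1=1..<i2. h20 M k Ys (Xs i1 \<omega>) (Xs i2 \<omega>))
     + 4 / (real n * real m) * (\<Sum>i=1..n. \<Sum>j=1..m. h11 M k Xs Ys (Xs i \<omega>) (Ys j \<omega>))
     + 1 / real (m choose 2) * (\<Sum>j2=1..m. \<Sum>j1=1..<j2. h02 M k Xs (Ys j1 \<omega>) (Ys j2 \<omega>))"


definition pooled :: "nat \<Rightarrow> (nat \<Rightarrow> 'b) \<Rightarrow> (nat \<Rightarrow> 'b) \<Rightarrow> nat \<Rightarrow> 'b" where
  "pooled n x y s = (if s \<le> n then x s else y (s - n))"

definition A_star :: "nat \<Rightarrow> (nat \<Rightarrow> nat \<Rightarrow> real) \<Rightarrow> nat \<Rightarrow> nat \<Rightarrow> real" where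
  "A_star N a s t =
     a s t
     - 1 / (real N - 2) * (\<Sum>i=1..N. a i t)
     - 1 / (real N - 2) * (\<Sum>j=1..N. a s j)
     + 1 / ((real N - 1) * (real N - 2)) * (\<Sum>i=1..N. \<Sum>j=1..N. a i j)"

definition V_star ::
  "('b \<Rightarrow> 'b \<Rightarrow> real) \<Rightarrow> real \<Rightarrow> nat \<Rightarrow> nat \<Rightarrow> (nat \<Rightarrow> 'a \<Rightarrow> 'b) \<Rightarrow> (nat \<Rightarrow> 'a \<Rightarrow> 'b) \<Rightarrow> 'a \<Rightarrow> real" where
  "V_star k a0 n m Xs Ys \<omega> =
     (let N = n + m;
          W = pooled n (\<lambda>i. Xs i \<omega>) (\<lambda>j. Ys j \<omega>);
          a = (\<lambda>s t. k (W s) (W t))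
      in 1 / (real N * (real N - 3)) * (\<Sum>s=1..N. \<Sum>t\<in>{1..N} - {s}. (A_star N a s t)\<^sup>2)
         - a0\<^sup>2 / ((real N - 1) * (real N - 3)))"


text \<open>Convergence in probability to a constant for variables on varying probability spaces.\<close>

definition conv_in_prob :: "(nat \<Rightarrow> 'a measure) \<Rightarrow> (nat \<Rightarrow> 'a \<Rightarrow> real) \<Rightarrow> real \<Rightarrow> bool" where
  "conv_in_prob M U c \<longleftrightarrow>
     (\<forall>\<epsilon>>0. (\<lambda>l. measure (M l) {\<omega> \<in> space (M l). \<bar>U l \<omega> - c\<bar> > \<epsilon>}) \<longlonglongrightarrow> 0)"

end

theory Submission
  imports Defs "HOL-Real_Asymp.Real_Asymp"
begin

text \<open>
  Under the null hypothesis the pooled sample \<open>W\<^sub>1, \<dots>, W\<^sub>N\<close> is i.i.d. with the law of \<open>Z\<close>. Let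
  \<open>H(x, y) = k(x, y) - E k(x, Z) - E k(Z, y) + E k(Z\<^sub>1, Z\<^sub>2)\<close> be the doubly centred kernel. It is
  degenerate, that is, \<open>E H(x, Z) = 0\<close> for almost every \<open>x\<close>; therefore
  \<open>H(W\<^sub>s, W\<^sub>t)\<close> and \<open>H(W\<^sub>u, W\<^sub>v)\<close> are orthogonal unless \<open>{s, t} = {u, v}\<close>
  (\<open>H_pairs_orthogonal\<close>), and \<open>E H\<^sup>2\<close> is the quantity \<open>V2\<close>, written \<open>V\<close> below (\<open>V2_eq_V\<close>).

  The centring of the array in the estimator removes every additive term \<open>f s + f t\<close>, and the
  correction by \<open>a0\<^sup>2\<close> compensates for the diagonal. What remains is an exact identity
  (\<open>bias_corrected_sum_of_squares\<close>): the estimator is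
  \<open>(S - 2 / (N - 2) \<Sum>\<^sub>s r\<^sub>s\<^sup>2 + T\<^sup>2 / ((N - 1) (N - 2))) / (N (N - 3))\<close>, where \<open>S\<close> is the sum
  of \<open>H(W\<^sub>s, W\<^sub>t)\<^sup>2\<close> over \<open>s \<noteq> t\<close>, \<open>r\<^sub>s\<close> are the row sums of \<open>H(W\<^sub>s, W\<^sub>t)\<close> off the diagonal and
  \<open>T\<close> is their total. By orthogonality \<open>E \<Sum>\<^sub>s r\<^sub>s\<^sup>2 = N (N - 1) V\<close>, and \<open>T\<^sup>2 \<le> N \<Sum>\<^sub>s r\<^sub>s\<^sup>2\<close>, so both
  corrections are of order \<open>V / N\<close> in mean.

  The main term is a U-statistic with the kernel \<open>G = H\<^sup>2 / V\<close> of mean \<open>1\<close>, whose variance the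
  moment condition does not control when \<open>\<tau> < 1\<close>. Truncation of \<open>G\<close> at the level \<open>N\<close> bounds its
  deviation in probability by a multiple of \<open>E G\<^bsup>1+\<tau>\<^esup> / N\<^bsup>\<tau>\<^esup>\<close> (\<open>u_statistic_weak_law\<close>). Double
  centring increases moments by at most a constant factor (\<open>H_moment_le\<close>), so this is bounded by a
  multiple of the ratio in the moment condition. All bounds hold for fixed sample sizes and dimension
  (\<open>V_star_deviation\<close>), and only the last step passes to the limit.

  For the second claim, the projected kernels of \<open>L\<close> are \<open>-H\<close>, \<open>H / 2\<close> and \<open>-H\<close>. Orthogonality
  turns the variance of \<open>L\<close> into \<open>V\<close> times the sum of the squared coefficients, which is
  \<open>c_coeff n m * V\<close> exactly (\<open>L_stat_variance\<close>). Both ratios of the theorem therefore coincide as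
  soon as each sample has at least two points.
\<close>

section \<open>Double centring of an array without its diagonal\<close>

definition row_sum :: "nat \<Rightarrow> (nat \<Rightarrow> nat \<Rightarrow> real) \<Rightarrow> nat \<Rightarrow> real" where
  "row_sum N e s = (\<Sum>t=1..N. e s t)"

text \<open>All arrays have a zero diagonal here, so that a row has \<open>N - 1\<close> relevant entries. The divisors
  \<open>N - 2\<close> and \<open>(N - 1) (N - 2)\<close>, in place of \<open>N\<close> and \<open>N\<^sup>2\<close>, make the centred rows sum to \<open>0\<close> when
  the diagonal entry is left out of the sum.\<close>

definition u_centred :: "nat \<Rightarrow> (nat \<Rightarrow> nat \<Rightarrow> real) \<Rightarrow> nat \<Rightarrow> nat \<Rightarrow> real" where
  "u_centred N e s t =
     e s t - (row_sum N e s + row_sum N e t) / (real N - 2)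
     + (\<Sum>i=1..N. row_sum N e i) / ((real N - 1) * (real N - 2))"

lemma sum_remove_index:
  fixes f :: "nat \<Rightarrow> real"
  assumes "s \<in> {1..N}"
  shows "(\<Sum>t\<in>{1..N} - {s}. f t) = (\<Sum>t=1..N. f t) - f s"
  using assms by (simp add: sum_diff1)

lemma u_centred_row_zero:
  assumes N: "N \<ge> 3" and diag: "\<And>s. e s s = 0" and s: "s \<in> {1..N}"
  shows "(\<Sum>t\<in>{1..N} - {s}. u_centred N e s t) = 0"
proof -
  let ?r = "row_sum N e" and ?T = "\<Sum>i=1..N. row_sum N e i"
  have n0: "real N - 2 \<noteq> 0" "real N - 1 \<noteq> 0" using N by auto
  have "(\<Sum>t\<in>{1..N} - {s}. u_centred N e s t)
      = (\<Sum>t=1..N. u_centred N e s t) - u_centred N e s s"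
    by (rule sum_remove_index[OF s])
  also have "(\<Sum>t=1..N. u_centred N e s t)
      = ?r s - (real N * ?r s + ?T) / (real N - 2)
        + real N * (?T / ((real N - 1) * (real N - 2)))"
    by (simp add: u_centred_def sum.distrib sum_subtractf sum_divide_distrib[symmetric] row_sum_def)
  also have "\<dots> - u_centred N e s s = 0"
    using n0 by (simp add: u_centred_def diag divide_simps) (simp add: algebra_simps)
  finally show ?thesis .
qed

text \<open>Since the rows and the columns of the centred array sum to \<open>0\<close> off the diagonal, one of the
  two factors of each square can be replaced by the original array.\<close>

lemma u_centred_sum_squares:
  assumes N: "N \<ge> 3" and sym: "\<And>s t. e s t = e t s" and diag: "\<And>s. e s s = 0"
  shows "(\<Sum>s=1..N. \<Sum>t\<in>{1..N} - {s}. (u_centred N e s t)\<^sup>2)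
    = (\<Sum>s=1..N. \<Sum>t\<in>{1..N} - {s}. (e s t)\<^sup>2)
      - 2 / (real N - 2) * (\<Sum>s=1..N. (row_sum N e s)\<^sup>2)
      + (\<Sum>s=1..N. row_sum N e s)\<^sup>2 / ((real N - 1) * (real N - 2))"
proof -
  define r T where "r = row_sum N e" and "T = (\<Sum>i=1..N. row_sum N e i)"
  define c where "c = T / ((real N - 1) * (real N - 2))"
  define B where "B = (\<lambda>s t. if s = t then 0 else u_centred N e s t)"
  have usym: "u_centred N e s t = u_centred N e t s" for s t
    by (simp add: u_centred_def sym[of s t] add.commute)
  have Bsym: "B s t = B t s" for s t by (simp add: B_def usym)
  have off: "(\<Sum>t\<in>{1..N} - {s}. f t) = (\<Sum>t=1..N. f t)" if "f s = 0" "s \<in> {1..N}"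
    for f :: "nat \<Rightarrow> real" and s
    using that sum_remove_index[of s N f] by simp
  have row: "(\<Sum>t=1..N. B s t) = 0" if "s \<in> {1..N}" for s
  proof -
    have "(\<Sum>t=1..N. B s t) = (\<Sum>t\<in>{1..N} - {s}. B s t)"
      by (rule off[symmetric]) (use that in \<open>auto simp: B_def\<close>)
    also have "\<dots> = (\<Sum>t\<in>{1..N} - {s}. u_centred N e s t)"
      by (rule sum.cong) (auto simp: B_def)
    finally show ?thesis using u_centred_row_zero[OF N, of e s, OF diag that] by simp
  qed
  have col: "(\<Sum>s=1..N. B s t) = 0" if "t \<in> {1..N}" for t
    using row[OF that] by (simp add: Bsym[of _ t])
  have expand: "u_centred N e s t = e s t - r s / (real N - 2) - r t / (real N - 2) + c" for s t
    by (simp add: u_centred_def r_def c_def T_def diff_divide_distrib add_divide_distrib)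
  have "(\<Sum>s=1..N. \<Sum>t\<in>{1..N} - {s}. (u_centred N e s t)\<^sup>2)
      = (\<Sum>s=1..N. \<Sum>t=1..N. B s t * u_centred N e s t)"
  proof (rule sum.cong[OF refl])
    fix s assume s: "s \<in> {1..N}"
    have "(\<Sum>t\<in>{1..N} - {s}. (u_centred N e s t)\<^sup>2) = (\<Sum>t\<in>{1..N} - {s}. B s t * u_centred N e s t)"
      by (rule sum.cong) (auto simp: B_def power2_eq_square)
    also have "\<dots> = (\<Sum>t=1..N. B s t * u_centred N e s t)"
      by (rule off) (use s in \<open>auto simp: B_def\<close>)
    finally show "(\<Sum>t\<in>{1..N} - {s}. (u_centred N e s t)\<^sup>2) = \<dots>" .
  qed
  also have "\<dots> = (\<Sum>s=1..N. \<Sum>t=1..N. B s t * e s t)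
        - (\<Sum>s=1..N. \<Sum>t=1..N. B s t * (r s / (real N - 2)))
        - (\<Sum>s=1..N. \<Sum>t=1..N. B s t * (r t / (real N - 2)))
        + (\<Sum>s=1..N. \<Sum>t=1..N. B s t * c)"
    unfolding expand by (simp add: algebra_simps sum.distrib sum_subtractf)
  also have "(\<Sum>s=1..N. \<Sum>t=1..N. B s t * (r s / (real N - 2))) = 0"
    by (rule sum.neutral) (use row in \<open>simp flip: sum_distrib_right sum_divide_distrib\<close>)
  also have "(\<Sum>s=1..N. \<Sum>t=1..N. B s t * (r t / (real N - 2))) = 0"
    by (subst sum.swap, rule sum.neutral)
       (use col in \<open>simp flip: sum_distrib_right sum_divide_distrib\<close>)
  also have "(\<Sum>s=1..N. \<Sum>t=1..N. B s t * c) = 0"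
    by (rule sum.neutral) (use row in \<open>simp flip: sum_distrib_right\<close>)
  also have "(\<Sum>s=1..N. \<Sum>t=1..N. B s t * e s t)
      = (\<Sum>s=1..N. \<Sum>t=1..N. (e s t)\<^sup>2 - e s t * r s / (real N - 2) - e s t * r t / (real N - 2)
          + c * e s t)"
    by (intro sum.cong refl)
       (auto simp: B_def diag expand power2_eq_square algebra_simps)
  also have "\<dots> = (\<Sum>s=1..N. \<Sum>t=1..N. (e s t)\<^sup>2)
        - (\<Sum>s=1..N. \<Sum>t=1..N. e s t * r s) / (real N - 2)
        - (\<Sum>s=1..N. \<Sum>t=1..N. e s t * r t) / (real N - 2)
        + c * (\<Sum>s=1..N. \<Sum>t=1..N. e s t)"
    by (simp add: sum.distrib sum_subtractf sum_divide_distrib sum_distrib_left)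
  also have "(\<Sum>s=1..N. \<Sum>t=1..N. e s t * r s) = (\<Sum>s=1..N. (r s)\<^sup>2)"
    by (simp add: r_def row_sum_def power2_eq_square flip: sum_distrib_right)
  also have "(\<Sum>s=1..N. \<Sum>t=1..N. e s t * r t) = (\<Sum>s=1..N. (r s)\<^sup>2)"
    by (subst sum.swap, subst sym)
       (simp add: r_def row_sum_def power2_eq_square flip: sum_distrib_right)
  also have "(\<Sum>s=1..N. \<Sum>t=1..N. e s t) = T"
    by (simp add: T_def row_sum_def)
  also have "(\<Sum>s=1..N. \<Sum>t=1..N. (e s t)\<^sup>2) = (\<Sum>s=1..N. \<Sum>t\<in>{1..N} - {s}. (e s t)\<^sup>2)"
    by (rule sum.cong[OF refl], rule off[symmetric]) (auto simp: diag)
  finally show ?thesis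
    by (simp add: c_def T_def r_def power2_eq_square)
qed

text \<open>Additive terms \<open>f s + f t\<close> cancel in the centring, and the constant diagonal \<open>a0\<close> shifts every
  off-diagonal entry of the centred array by the same amount.\<close>

lemma A_star_eq_u_centred:
  assumes N: "N \<ge> 3" and diag: "\<And>s. e s s = 0"
    and a_diag: "\<And>s. s \<in> {1..N} \<Longrightarrow> a s s = a0"
    and a_off: "\<And>s t. s \<in> {1..N} \<Longrightarrow> t \<in> {1..N} \<Longrightarrow> s \<noteq> t \<Longrightarrow> a s t = e s t + f s + f t"
    and sym: "\<And>s t. e s t = e t s"
    and s: "s \<in> {1..N}" and t: "t \<in> {1..N}" and "s \<noteq> t"
  shows "A_star N a s t = u_centred N e s t - a0 / (real N - 1)"
proof -
  define F where "F = (\<Sum>i=1..N. f i)"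
  have n0: "real N - 2 \<noteq> 0" "real N - 1 \<noteq> 0" using N by auto
  have row: "(\<Sum>j=1..N. a s j) = a0 + row_sum N e s + (real N - 2) * f s + F" if s: "s \<in> {1..N}" for s
  proof -
    have "(\<Sum>j=1..N. a s j) = (\<Sum>j\<in>{1..N} - {s}. a s j) + a0"
      using sum_remove_index[OF s, of "a s"] a_diag[OF s] by simp
    also have "(\<Sum>j\<in>{1..N} - {s}. a s j) = (\<Sum>j\<in>{1..N} - {s}. e s j + f s + f j)"
      by (rule sum.cong) (use s a_off in auto)
    also have "\<dots> = row_sum N e s + (real N - 2) * f s + F"
      using sum_remove_index[OF s, of "\<lambda>j. e s j + f s + f j"]
      by (simp add: sum.distrib row_sum_def F_def diag algebra_simps)
    finally show ?thesis by simp
  qed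
  have a_sym: "a i j = a j i" if "i \<in> {1..N}" "j \<in> {1..N}" for i j
    using that a_off[of i j] a_off[of j i] sym[of i j] by (cases "i = j") auto
  have col: "(\<Sum>i=1..N. a i t) = a0 + row_sum N e t + (real N - 2) * f t + F"
  proof -
    have "(\<Sum>i=1..N. a i t) = (\<Sum>i=1..N. a t i)"
      by (rule sum.cong[OF refl]) (rule a_sym[OF _ t])
    then show ?thesis using row[OF t] by simp
  qed
  have "(\<Sum>i=1..N. \<Sum>j=1..N. a i j)
      = (\<Sum>i=1..N. a0 + row_sum N e i + (real N - 2) * f i + F)"
    by (rule sum.cong[OF refl row])
  also have "\<dots> = real N * a0 + (\<Sum>i=1..N. row_sum N e i) + (real N - 2) * F + real N * F"
    by (simp add: sum.distrib F_def sum_distrib_left)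
  finally have total: "(\<Sum>i=1..N. \<Sum>j=1..N. a i j) = \<dots>" .
  show ?thesis
    unfolding A_star_def u_centred_def row[OF s] col total a_off[OF s t \<open>s \<noteq> t\<close>]
    using n0 by (simp add: divide_simps) (simp add: algebra_simps)
qed

text \<open>The shift \<open>a0 / (N - 1)\<close> has no cross term with the centred array, whose rows sum to \<open>0\<close>, so
  it adds precisely the bias \<open>a0\<^sup>2 / ((N - 1) (N - 3))\<close> that the estimator subtracts.\<close>

lemma bias_corrected_sum_of_squares:
  assumes N: "N \<ge> 4" and diag: "\<And>s. e s s = 0"
    and a_diag: "\<And>s. s \<in> {1..N} \<Longrightarrow> a s s = a0"
    and a_off: "\<And>s t. s \<in> {1..N} \<Longrightarrow> t \<in> {1..N} \<Longrightarrow> s \<noteq> t \<Longrightarrow> a s t = e s t + f s + f t"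
    and sym: "\<And>s t. e s t = e t s"
  shows "1 / (real N * (real N - 3)) * (\<Sum>s=1..N. \<Sum>t\<in>{1..N} - {s}. (A_star N a s t)\<^sup>2)
      - a0\<^sup>2 / ((real N - 1) * (real N - 3))
    = 1 / (real N * (real N - 3)) *
      ((\<Sum>s=1..N. \<Sum>t\<in>{1..N} - {s}. (e s t)\<^sup>2)
      - 2 / (real N - 2) * (\<Sum>s=1..N. (row_sum N e s)\<^sup>2)
      + (\<Sum>s=1..N. row_sum N e s)\<^sup>2 / ((real N - 1) * (real N - 2)))"
proof -
  let ?d = "a0 / (real N - 1)"
  have N3: "N \<ge> 3" using N by simp
  have n0: "real N - 1 \<noteq> 0" "real N - 3 \<noteq> 0" "real N \<noteq> 0" using N by auto
  have "(\<Sum>s=1..N. \<Sum>t\<in>{1..N} - {s}. (A_star N a s t)\<^sup>2)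
      = (\<Sum>s=1..N. \<Sum>t\<in>{1..N} - {s}. (u_centred N e s t)\<^sup>2 - 2 * ?d * u_centred N e s t + ?d\<^sup>2)"
    by (intro sum.cong refl)
       (subst A_star_eq_u_centred[OF N3 diag a_diag a_off sym],
        auto simp: power2_diff algebra_simps)
  also have "\<dots> = (\<Sum>s=1..N. (\<Sum>t\<in>{1..N} - {s}. (u_centred N e s t)\<^sup>2)
      - 2 * ?d * (\<Sum>t\<in>{1..N} - {s}. u_centred N e s t) + (\<Sum>t\<in>{1..N} - {s}. ?d\<^sup>2))"
    by (simp only: sum.distrib sum_subtractf sum_distrib_left)
  also have "\<dots> = (\<Sum>s=1..N. (\<Sum>t\<in>{1..N} - {s}. (u_centred N e s t)\<^sup>2) + (real N - 1) * ?d\<^sup>2)"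
    using N by (intro sum.cong refl, subst u_centred_row_zero[OF N3 diag])
      (simp_all add: of_nat_diff)
  also have "\<dots> = (\<Sum>s=1..N. \<Sum>t\<in>{1..N} - {s}. (u_centred N e s t)\<^sup>2) + real N * ((real N - 1) * ?d\<^sup>2)"
    by (simp add: sum.distrib)
  also have "1 / (real N * (real N - 3)) * \<dots> - a0\<^sup>2 / ((real N - 1) * (real N - 3))
      = 1 / (real N * (real N - 3)) * (\<Sum>s=1..N. \<Sum>t\<in>{1..N} - {s}. (u_centred N e s t)\<^sup>2)"
    using n0 by (simp add: divide_simps) (simp add: power2_eq_square algebra_simps)
  finally show ?thesis
    unfolding u_centred_sum_squares[OF N3 sym diag] .
qed

section \<open>Double centring of a square-integrable kernel\<close>

text \<open>Integrate Young's inequality for the product of \<open>\<bar>f\<bar>\<close> and the constant \<open>(E \<bar>f\<bar>)\<^bsup>q-1\<^esup>\<close>; the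
  conjugate exponent turns the constant into \<open>(E \<bar>f\<bar>)\<^bsup>q\<^esup>\<close>, which is then absorbed on the left.\<close>

lemma (in prob_space) power_mean:
  fixes f :: "'a \<Rightarrow> real"
  assumes q: "q > 1" and [measurable]: "f \<in> borel_measurable M"
    and int: "integrable M (\<lambda>x. \<bar>f x\<bar> powr q)"
  shows "integrable M f" "\<bar>\<integral>x. f x \<partial>M\<bar> powr q \<le> (\<integral>x. \<bar>f x\<bar> powr q \<partial>M)"
proof -
  show f: "integrable M f"
  proof (rule Bochner_Integration.integrable_bound)
    show "integrable M (\<lambda>x. 1 + \<bar>f x\<bar> powr q)" using int by simp
    show "AE x in M. norm (f x) \<le> norm (1 + \<bar>f x\<bar> powr q)"
    proof (rule AE_I2)
      fix x
      have "\<bar>f x\<bar> \<le> 1 + \<bar>f x\<bar> powr q"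
      proof (cases "\<bar>f x\<bar> \<le> 1")
        case False
        then have "\<bar>f x\<bar> powr 1 \<le> \<bar>f x\<bar> powr q" using q by (intro powr_mono) auto
        then show ?thesis using False by simp
      qed (simp add: add_increasing2)
      then show "norm (f x) \<le> norm (1 + \<bar>f x\<bar> powr q)" by simp
    qed
  qed simp
  define y where "y = (\<integral>x. \<bar>f x\<bar> \<partial>M)"
  define I where "I = (\<integral>x. \<bar>f x\<bar> powr q \<partial>M)"
  define q' where "q' = q / (q - 1)"
  have q': "q' > 1" "1 / q + 1 / q' = 1" "(q - 1) * q' = q" using q by (auto simp: q'_def field_simps)
  have y0: "y \<ge> 0" by (simp add: y_def)
  have "y * y powr (q - 1) = (\<integral>x. \<bar>f x\<bar> * y powr (q - 1) \<partial>M)" by (simp add: y_def)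
  also have "\<dots> \<le> (\<integral>x. \<bar>f x\<bar> powr q / q + y powr q / q' \<partial>M)"
  proof (rule integral_mono)
    fix x
    show "\<bar>f x\<bar> * y powr (q - 1) \<le> \<bar>f x\<bar> powr q / q + y powr q / q'"
      using Youngs_inequality[of q q' "\<bar>f x\<bar>" "y powr (q - 1)"] q q' by (simp add: powr_powr)
  qed (use f int in auto)
  also have "\<dots> = I / q + y powr q / q'" using int by (simp add: I_def prob_space)
  finally have "y powr q \<le> I / q + y powr q / q'"
    using y0 by (cases "y = 0") (auto simp: powr_diff)
  then have "y powr q * (1 - 1 / q') \<le> I / q" by (simp add: algebra_simps)
  moreover have "1 - 1 / q' = 1 / q" using q' by simp
  ultimately have "y powr q \<le> I" using q by (simp add: field_simps)
  moreover have "\<bar>\<integral>x. f x \<partial>M\<bar> powr q \<le> y powr q"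
    using q integral_abs_bound[of M f] by (intro powr_mono2) (auto simp: y_def)
  ultimately show "\<bar>\<integral>x. f x \<partial>M\<bar> powr q \<le> (\<integral>x. \<bar>f x\<bar> powr q \<partial>M)" by (simp add: I_def)
qed

lemma powr_abs_sum3:
  fixes a b c q :: real
  assumes "q > 0"
  shows "\<bar>a - b - c\<bar> powr q \<le> 3 powr q * (\<bar>a\<bar> powr q + \<bar>b\<bar> powr q + \<bar>c\<bar> powr q)"
proof -
  define m where "m = max \<bar>a\<bar> (max \<bar>b\<bar> \<bar>c\<bar>)"
  have "\<bar>a - b - c\<bar> powr q \<le> (3 * m) powr q"
    using assms by (intro powr_mono2) (auto simp: m_def)
  also have "\<dots> = 3 powr q * m powr q" by (rule powr_mult)
  also have "m powr q \<le> \<bar>a\<bar> powr q + \<bar>b\<bar> powr q + \<bar>c\<bar> powr q"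
    by (auto simp: m_def max_def)
  finally show ?thesis by simp
qed

text \<open>Let \<open>x\<close> and \<open>y\<close> be independent with law \<open>\<mu>\<close>. Then \<open>k1\<close> is the conditional expectation of the
  kernel given one point, and \<open>H\<close> is what remains after both one-point projections are removed.
  At the points \<open>x\<close> where \<open>k x\<close> is not integrable, the integral \<open>k1 x\<close> has the default value \<open>0\<close>,
  and \<open>H x\<close> need not have mean zero. These points form a null set, which is why the degeneracy of
  \<open>H\<close> is an almost sure statement.\<close>

locale pair_kernel = prob_space \<mu> for \<mu> :: "'b measure" +
  fixes k :: "'b \<Rightarrow> 'b \<Rightarrow> real"
  assumes k_measurable[measurable]: "(\<lambda>z. k (fst z) (snd z)) \<in> borel_measurable (\<mu> \<Otimes>\<^sub>M \<mu>)"
    and k_sym: "\<And>x y. x \<in> space \<mu> \<Longrightarrow> y \<in> space \<mu> \<Longrightarrow> k x y = k y x"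
    and k_square_integrable: "integrable (\<mu> \<Otimes>\<^sub>M \<mu>) (\<lambda>z. (k (fst z) (snd z))\<^sup>2)"
begin

sublocale pair: pair_prob_space \<mu> \<mu> ..

definition mean :: real where
  "mean = (\<integral>z. k (fst z) (snd z) \<partial>(\<mu> \<Otimes>\<^sub>M \<mu>))"

definition k1 :: "'b \<Rightarrow> real" where
  "k1 x = (\<integral>y. k x y \<partial>\<mu>)"

definition H :: "'b \<Rightarrow> 'b \<Rightarrow> real" where
  "H x y = k x y - k1 x - k1 y + mean"

definition V :: real where
  "V = (\<integral>z. (H (fst z) (snd z))\<^sup>2 \<partial>(\<mu> \<Otimes>\<^sub>M \<mu>))"

lemma k_measurable'[measurable (raw)]:
  assumes "f \<in> measurable L \<mu>" "g \<in> measurable L \<mu>"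
  shows "(\<lambda>x. k (f x) (g x)) \<in> borel_measurable L"
  using measurable_compose[OF measurable_Pair[OF assms] k_measurable] by simp

lemma k1_measurable[measurable]: "k1 \<in> borel_measurable \<mu>"
  unfolding k1_def by measurable

lemma H_measurable[measurable (raw)]:
  assumes [measurable]: "f \<in> measurable L \<mu>" "g \<in> measurable L \<mu>"
  shows "(\<lambda>x. H (f x) (g x)) \<in> borel_measurable L"
  unfolding H_def by measurable

lemma H_sym: "x \<in> space \<mu> \<Longrightarrow> y \<in> space \<mu> \<Longrightarrow> H x y = H y x"
  by (simp add: H_def k_sym)

lemma distr_fst: "distr (\<mu> \<Otimes>\<^sub>M \<mu>) \<mu> fst = \<mu>"
  by (rule distr_pair_fst) unfold_locales

lemma distr_snd: "distr (\<mu> \<Otimes>\<^sub>M \<mu>) \<mu> snd = \<mu>"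
proof (rule measure_eqI)
  fix A assume "A \<in> sets (distr (\<mu> \<Otimes>\<^sub>M \<mu>) \<mu> snd)"
  then have A: "A \<in> sets \<mu>" by simp
  have "snd -` A \<inter> space (\<mu> \<Otimes>\<^sub>M \<mu>) = space \<mu> \<times> A"
    using sets.sets_into_space[OF A] by (auto simp: space_pair_measure)
  then show "emeasure (distr (\<mu> \<Otimes>\<^sub>M \<mu>) \<mu> snd) A = emeasure \<mu> A"
    using A by (simp add: emeasure_distr emeasure_pair_measure_Times emeasure_space_1)
qed simp

lemma coordinate_integral:
  fixes f :: "'b \<Rightarrow> real"
  assumes [measurable]: "f \<in> borel_measurable \<mu>"
  shows "integrable (\<mu> \<Otimes>\<^sub>M \<mu>) (\<lambda>z. f (fst z)) \<longleftrightarrow> integrable \<mu> f"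
    and "integrable (\<mu> \<Otimes>\<^sub>M \<mu>) (\<lambda>z. f (snd z)) \<longleftrightarrow> integrable \<mu> f"
    and "(\<integral>z. f (fst z) \<partial>(\<mu> \<Otimes>\<^sub>M \<mu>)) = (\<integral>x. f x \<partial>\<mu>)"
    and "(\<integral>z. f (snd z) \<partial>(\<mu> \<Otimes>\<^sub>M \<mu>)) = (\<integral>x. f x \<partial>\<mu>)"
  using integrable_distr_eq[of fst "\<mu> \<Otimes>\<^sub>M \<mu>" \<mu> f] integrable_distr_eq[of snd "\<mu> \<Otimes>\<^sub>M \<mu>" \<mu> f]
    integral_distr[of fst "\<mu> \<Otimes>\<^sub>M \<mu>" \<mu> f] integral_distr[of snd "\<mu> \<Otimes>\<^sub>M \<mu>" \<mu> f]
  by (simp_all add: distr_fst distr_snd)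

lemma k_integrable: "integrable (\<mu> \<Otimes>\<^sub>M \<mu>) (\<lambda>z. k (fst z) (snd z))"
  by (rule pair.square_integrable_imp_integrable) (use k_square_integrable in auto)

lemma AE_k_integrable: "AE x in \<mu>. integrable \<mu> (k x)"
  using pair.AE_integrable_fst'[OF k_integrable] by simp

lemma k1_integrable: "integrable \<mu> k1" and integral_k1: "(\<integral>x. k1 x \<partial>\<mu>) = mean"
  using pair.integrable_fst'[OF k_integrable] pair.integral_fst'[OF k_integrable]
  by (simp_all add: k1_def[abs_def] mean_def)

lemma AE_H_integral_zero: "AE x in \<mu>. (\<integral>y. H x y \<partial>\<mu>) = 0"
  using AE_k_integrable
proof eventually_elim
  case (elim x)
  then have "(\<integral>y. H x y \<partial>\<mu>) = (\<integral>y. k x y \<partial>\<mu>) - k1 x - mean + mean"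
    using k1_integrable by (simp add: H_def prob_space integral_k1)
  then show ?case by (simp add: k1_def)
qed

text \<open>Off a null set, \<open>k1 x - mean\<close> is the integral of \<open>k x y - mean\<close> over \<open>y\<close>, so that the inequality
  between power means applies for each fixed \<open>x\<close>.\<close>

lemma k1_moment_le:
  assumes q: "q > 1" and int: "integrable (\<mu> \<Otimes>\<^sub>M \<mu>) (\<lambda>z. \<bar>k (fst z) (snd z) - mean\<bar> powr q)"
  shows "integrable \<mu> (\<lambda>x. \<bar>k1 x - mean\<bar> powr q)"
    and "(\<integral>x. \<bar>k1 x - mean\<bar> powr q \<partial>\<mu>)
      \<le> (\<integral>z. \<bar>k (fst z) (snd z) - mean\<bar> powr q \<partial>(\<mu> \<Otimes>\<^sub>M \<mu>))"
proof -
  define P where "P = (\<lambda>x. \<integral>y. \<bar>k x y - mean\<bar> powr q \<partial>\<mu>)"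
  have P: "integrable \<mu> P"
    "(\<integral>x. P x \<partial>\<mu>) = (\<integral>z. \<bar>k (fst z) (snd z) - mean\<bar> powr q \<partial>(\<mu> \<Otimes>\<^sub>M \<mu>))"
    using pair.integrable_fst'[OF int] pair.integral_fst'[OF int] by (simp_all add: P_def[abs_def])
  have le: "AE x in \<mu>. \<bar>k1 x - mean\<bar> powr q \<le> P x"
    using AE_k_integrable pair.AE_integrable_fst'[OF int] AE_space
  proof eventually_elim
    case (elim x)
    from elim(3) have [measurable]: "k x \<in> borel_measurable \<mu>" by measurable
    have "(\<integral>y. k x y - mean \<partial>\<mu>) = k1 x - mean" using elim(1) by (simp add: k1_def prob_space)
    then show ?case
      using power_mean(2)[of q "\<lambda>y. k x y - mean"] elim(2) q by (simp add: P_def)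
  qed
  show int1: "integrable \<mu> (\<lambda>x. \<bar>k1 x - mean\<bar> powr q)"
    by (rule Bochner_Integration.integrable_bound[OF P(1)]) (use le in auto)
  show "(\<integral>x. \<bar>k1 x - mean\<bar> powr q \<partial>\<mu>)
      \<le> (\<integral>z. \<bar>k (fst z) (snd z) - mean\<bar> powr q \<partial>(\<mu> \<Otimes>\<^sub>M \<mu>))"
    using integral_mono_AE[OF int1 P(1) le] P(2) by simp
qed

text \<open>Double centring increases the absolute moment of order \<open>q\<close> by at most a constant factor: \<open>H\<close> is
  the centred kernel minus its two one-variable projections, and a projection does not increase
  this moment.\<close>

lemma H_moment_le:
  assumes q: "q > 1" and int: "integrable (\<mu> \<Otimes>\<^sub>M \<mu>) (\<lambda>z. \<bar>k (fst z) (snd z) - mean\<bar> powr q)"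
  shows "integrable (\<mu> \<Otimes>\<^sub>M \<mu>) (\<lambda>z. \<bar>H (fst z) (snd z)\<bar> powr q)"
    and "(\<integral>z. \<bar>H (fst z) (snd z)\<bar> powr q \<partial>(\<mu> \<Otimes>\<^sub>M \<mu>))
      \<le> 3 powr (q + 1) * (\<integral>z. \<bar>k (fst z) (snd z) - mean\<bar> powr q \<partial>(\<mu> \<Otimes>\<^sub>M \<mu>))"
proof -
  define D where "D = (\<integral>z. \<bar>k (fst z) (snd z) - mean\<bar> powr q \<partial>(\<mu> \<Otimes>\<^sub>M \<mu>))"
  define p where "p = (\<lambda>x. \<bar>k1 x - mean\<bar> powr q)"
  have [measurable]: "p \<in> borel_measurable \<mu>" by (simp add: p_def)
  have p_int: "integrable \<mu> p" and p_le: "(\<integral>x. p x \<partial>\<mu>) \<le> D"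
    using k1_moment_le[OF q int] by (simp_all add: p_def D_def)
  define F where "F = (\<lambda>z. 3 powr q * (\<bar>k (fst z) (snd z) - mean\<bar> powr q + p (fst z) + p (snd z)))"
  have F: "integrable (\<mu> \<Otimes>\<^sub>M \<mu>) F"
    unfolding F_def using int p_int by (simp add: coordinate_integral)
  have HF: "\<bar>H (fst z) (snd z)\<bar> powr q \<le> F z" for z
    using powr_abs_sum3[of q "k (fst z) (snd z) - mean" "k1 (fst z) - mean" "k1 (snd z) - mean"] q
    by (simp add: H_def F_def p_def algebra_simps)
  show Hint: "integrable (\<mu> \<Otimes>\<^sub>M \<mu>) (\<lambda>z. \<bar>H (fst z) (snd z)\<bar> powr q)"
    by (rule Bochner_Integration.integrable_bound[OF F])
       (use HF in \<open>auto intro!: AE_I2 intro: order_trans[OF _ abs_ge_self]\<close>)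
  have "(\<integral>z. \<bar>H (fst z) (snd z)\<bar> powr q \<partial>(\<mu> \<Otimes>\<^sub>M \<mu>)) \<le> (\<integral>z. F z \<partial>(\<mu> \<Otimes>\<^sub>M \<mu>))"
    by (rule integral_mono[OF Hint F HF])
  also have "\<dots> = 3 powr q * (D + (\<integral>x. p x \<partial>\<mu>) + (\<integral>x. p x \<partial>\<mu>))"
    unfolding F_def using int p_int by (simp add: coordinate_integral D_def)
  also have "\<dots> \<le> 3 powr q * (3 * D)" using p_le by (intro mult_left_mono) auto
  also have "\<dots> = 3 powr (q + 1) * D" by (simp add: powr_add)
  finally show "(\<integral>z. \<bar>H (fst z) (snd z)\<bar> powr q \<partial>(\<mu> \<Otimes>\<^sub>M \<mu>)) \<le> 3 powr (q + 1) * D" .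
qed

lemma centred_square_integrable:
  "integrable (\<mu> \<Otimes>\<^sub>M \<mu>) (\<lambda>z. \<bar>k (fst z) (snd z) - mean\<bar> powr 2)"
proof -
  have "integrable (\<mu> \<Otimes>\<^sub>M \<mu>) (\<lambda>z. (k (fst z) (snd z))\<^sup>2 - 2 * mean * k (fst z) (snd z) + mean\<^sup>2)"
    using k_square_integrable k_integrable by simp
  then show ?thesis by (simp add: power2_diff algebra_simps)
qed

lemma H_square_integrable: "integrable (\<mu> \<Otimes>\<^sub>M \<mu>) (\<lambda>z. (H (fst z) (snd z))\<^sup>2)"
  using H_moment_le(1)[OF _ centred_square_integrable] by simp

lemma k1_square_integrable: "integrable \<mu> (\<lambda>x. (k1 x)\<^sup>2)"
proof -
  have "integrable \<mu> (\<lambda>x. (k1 x - mean)\<^sup>2)"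
    using k1_moment_le(1)[OF _ centred_square_integrable] by simp
  then have "integrable \<mu> (\<lambda>x. (k1 x - mean)\<^sup>2 + 2 * mean * k1 x - mean\<^sup>2)"
    using k1_integrable by simp
  then show ?thesis by (simp add: power2_diff algebra_simps)
qed

end

section \<open>Independence and degeneracy\<close>

lemma integrable_product_of_squares:
  fixes f g :: "'a \<Rightarrow> real"
  assumes "f \<in> borel_measurable M" "g \<in> borel_measurable M"
    and "integrable M (\<lambda>x. (f x)\<^sup>2)" "integrable M (\<lambda>x. (g x)\<^sup>2)"
  shows "integrable M (\<lambda>x. f x * g x)"
proof (rule Bochner_Integration.integrable_bound)
  show "integrable M (\<lambda>x. (f x)\<^sup>2 + (g x)\<^sup>2)" using assms by simp
  show "AE x in M. norm (f x * g x) \<le> norm ((f x)\<^sup>2 + (g x)\<^sup>2)"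
  proof (rule AE_I2)
    fix x
    have "2 * (\<bar>f x\<bar> * \<bar>g x\<bar>) \<le> (f x)\<^sup>2 + (g x)\<^sup>2"
      using sum_squares_bound[of "\<bar>f x\<bar>" "\<bar>g x\<bar>"] by simp
    moreover have "0 \<le> \<bar>f x\<bar> * \<bar>g x\<bar>" by simp
    ultimately have "\<bar>f x\<bar> * \<bar>g x\<bar> \<le> (f x)\<^sup>2 + (g x)\<^sup>2" by linarith
    then show "norm (f x * g x) \<le> norm ((f x)\<^sup>2 + (g x)\<^sup>2)" by (simp add: abs_mult)
  qed
qed (use assms in simp)

text \<open>This is Fubini's theorem for the joint law of two independent variables.\<close>

lemma (in prob_space) expectation_zero_of_fibres:
  assumes ind: "indep_var A U B W"
    and [measurable]: "F \<in> borel_measurable (A \<Otimes>\<^sub>M B)"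
    and int: "integrable M (\<lambda>\<omega>. F (U \<omega>, W \<omega>) :: real)"
    and fibre: "AE \<omega> in M. (\<integral>\<omega>'. F (U \<omega>, W \<omega>') \<partial>M) = 0"
  shows "(\<integral>\<omega>. F (U \<omega>, W \<omega>) \<partial>M) = 0"
proof -
  from ind have [measurable]: "U \<in> measurable M A" "W \<in> measurable M B"
    by (auto dest: indep_var_rv1 indep_var_rv2)
  have distr: "distr M A U \<Otimes>\<^sub>M distr M B W = distr M (A \<Otimes>\<^sub>M B) (\<lambda>\<omega>. (U \<omega>, W \<omega>))"
    using ind by (simp add: indep_var_distribution_eq)
  interpret U: prob_space "distr M A U" by (rule prob_space_distr) simp
  interpret W: prob_space "distr M B W" by (rule prob_space_distr) simp
  interpret UW: pair_prob_space "distr M A U" "distr M B W" ..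
  have int': "integrable (distr M A U \<Otimes>\<^sub>M distr M B W) F"
    unfolding distr using int by (subst integrable_distr_eq) simp_all
  have "(\<integral>\<omega>. F (U \<omega>, W \<omega>) \<partial>M) = integral\<^sup>L (distr M A U \<Otimes>\<^sub>M distr M B W) F"
    unfolding distr by (subst integral_distr) simp_all
  also have "\<dots> = (\<integral>u. (\<integral>w. F (u, w) \<partial>distr M B W) \<partial>distr M A U)"
    by (rule UW.integral_fst'[OF int', symmetric])
  also have "\<dots> = (\<integral>\<omega>. (\<integral>w. F (U \<omega>, w) \<partial>distr M B W) \<partial>M)"
    using borel_measurable_integrable[OF UW.integrable_fst'[OF int']]
    by (intro integral_distr) simp_all
  also have "\<dots> = (\<integral>\<omega>. (\<integral>\<omega>'. F (U \<omega>, W \<omega>') \<partial>M) \<partial>M)"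
  proof (intro Bochner_Integration.integral_cong refl integral_distr)
    fix \<omega> assume "\<omega> \<in> space M"
    then have "U \<omega> \<in> space A" by (rule measurable_space[rotated]) simp
    then show "(\<lambda>w. F (U \<omega>, w)) \<in> borel_measurable B" by measurable
  qed simp
  also have "\<dots> = 0"
    using fibre by (simp add: integral_eq_zero_AE)
  finally show ?thesis .
qed

lemma (in prob_space) indep_var_coordinates:
  assumes ind: "indep_vars (\<lambda>_. N) X I" and "A \<subseteq> I" "B \<subseteq> I" "A \<inter> B = {}"
    and f: "f \<in> measurable (PiM A (\<lambda>_. N)) S" and g: "g \<in> measurable (PiM B (\<lambda>_. N)) T"
  shows "indep_var S (\<lambda>\<omega>. f (\<lambda>i\<in>A. X i \<omega>)) T (\<lambda>\<omega>. g (\<lambda>i\<in>B. X i \<omega>))"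
  using indep_var_compose[OF indep_var_restrict[OF ind \<open>A \<inter> B = {}\<close> \<open>A \<subseteq> I\<close> \<open>B \<subseteq> I\<close>] f g]
  by (simp add: comp_def)

lemma (in prob_space) indep_vars_pair_distr:
  assumes ind: "indep_vars (\<lambda>_. N) X I" and "s \<in> I" "t \<in> I" "s \<noteq> t"
  shows "distr M (N \<Otimes>\<^sub>M N) (\<lambda>\<omega>. (X s \<omega>, X t \<omega>)) = distr M N (X s) \<Otimes>\<^sub>M distr M N (X t)"
proof -
  have "indep_var N (\<lambda>\<omega>. (\<lambda>\<phi>. \<phi> s) (\<lambda>i\<in>{s}. X i \<omega>)) N (\<lambda>\<omega>. (\<lambda>\<phi>. \<phi> t) (\<lambda>i\<in>{t}. X i \<omega>))"
    by (rule indep_var_coordinates[OF ind]) (use assms in auto)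
  then show ?thesis by (simp add: indep_var_distribution_eq)
qed

lemma (in prob_space) indep_vars_reindex_inj:
  assumes ind: "indep_vars (\<lambda>_. N) X I" and "inj_on f J" "f ` J \<subseteq> I"
  shows "indep_vars (\<lambda>_. N) (\<lambda>j. X (f j)) J"
proof -
  have "indep_vars (\<lambda>j. PiM {f j} (\<lambda>_. N)) (\<lambda>j \<omega>. restrict (\<lambda>i. X i \<omega>) {f j}) J"
    by (rule indep_vars_restrict[OF ind])
       (use assms in \<open>auto simp: disjoint_family_on_def inj_on_def\<close>)
  from indep_vars_compose2[OF this, of "\<lambda>j \<phi>. \<phi> (f j)" "\<lambda>_. N"] show ?thesis by simp
qed

lemma (in prob_space) indep_vars_cong_sets:
  assumes "indep_vars (\<lambda>_. N) X I" and sets: "sets N = sets N'"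
  shows "indep_vars (\<lambda>_. N') X I"
  using assms(1) unfolding indep_vars_def2 by (simp add: sets measurable_cong_sets[OF refl sets])

locale iid_sample = pair_kernel \<mu> k + S: prob_space M
  for \<mu> :: "'b measure" and k :: "'b \<Rightarrow> 'b \<Rightarrow> real" and M :: "'a measure" +
  fixes W :: "nat \<Rightarrow> 'a \<Rightarrow> 'b" and I :: "nat set"
  assumes indep: "S.indep_vars (\<lambda>_. \<mu>) W I"
    and law: "\<And>i. i \<in> I \<Longrightarrow> distr M \<mu> (W i) = \<mu>"
begin

lemma W_measurable[measurable]: "i \<in> I \<Longrightarrow> W i \<in> measurable M \<mu>"
  using indep by (simp add: S.indep_vars_def)

lemma AE_W:
  assumes "AE x in \<mu>. P x" "i \<in> I"
  shows "AE \<omega> in M. P (W i \<omega>)"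
proof (rule AE_distrD[OF W_measurable[OF assms(2)]])
  show "AE x in distr M \<mu> (W i). P x" by (subst law) (use assms in auto)
qed

lemma expectation_W:
  assumes [measurable]: "f \<in> borel_measurable \<mu>" "i \<in> I"
  shows "integrable M (\<lambda>\<omega>. f (W i \<omega>) :: real) \<longleftrightarrow> integrable \<mu> f"
    and "(\<integral>\<omega>. f (W i \<omega>) \<partial>M) = (\<integral>x. f x \<partial>\<mu>)"
  using integrable_distr_eq[of "W i" M \<mu> f] integral_distr[of "W i" M \<mu> f]
  by (simp_all add: law[OF assms(2)])

lemma pair_law:
  assumes "s \<in> I" "t \<in> I" "s \<noteq> t"
  shows "distr M (\<mu> \<Otimes>\<^sub>M \<mu>) (\<lambda>\<omega>. (W s \<omega>, W t \<omega>)) = \<mu> \<Otimes>\<^sub>M \<mu>"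
  using S.indep_vars_pair_distr[OF indep assms] law assms by simp

lemma expectation_pair:
  assumes "s \<in> I" "t \<in> I" "s \<noteq> t" and [measurable]: "F \<in> borel_measurable (\<mu> \<Otimes>\<^sub>M \<mu>)"
  shows "integrable M (\<lambda>\<omega>. F (W s \<omega>, W t \<omega>) :: real) \<longleftrightarrow> integrable (\<mu> \<Otimes>\<^sub>M \<mu>) F"
    and "(\<integral>\<omega>. F (W s \<omega>, W t \<omega>) \<partial>M) = (\<integral>z. F z \<partial>(\<mu> \<Otimes>\<^sub>M \<mu>))"
proof -
  have [measurable]: "(\<lambda>\<omega>. (W s \<omega>, W t \<omega>)) \<in> measurable M (\<mu> \<Otimes>\<^sub>M \<mu>)"
    using assms by measurable
  show "integrable M (\<lambda>\<omega>. F (W s \<omega>, W t \<omega>)) \<longleftrightarrow> integrable (\<mu> \<Otimes>\<^sub>M \<mu>) F"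
    and "(\<integral>\<omega>. F (W s \<omega>, W t \<omega>) \<partial>M) = (\<integral>z. F z \<partial>(\<mu> \<Otimes>\<^sub>M \<mu>))"
    using integrable_distr_eq[of "\<lambda>\<omega>. (W s \<omega>, W t \<omega>)" M "\<mu> \<Otimes>\<^sub>M \<mu>" F]
      integral_distr[of "\<lambda>\<omega>. (W s \<omega>, W t \<omega>)" M "\<mu> \<Otimes>\<^sub>M \<mu>" F]
    by (simp_all add: pair_law[OF assms(1-3)])
qed

lemma H_pair:
  assumes "s \<in> I" "t \<in> I" "s \<noteq> t"
  shows "integrable M (\<lambda>\<omega>. (H (W s \<omega>) (W t \<omega>))\<^sup>2)"
    and "(\<integral>\<omega>. (H (W s \<omega>) (W t \<omega>))\<^sup>2 \<partial>M) = V"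
  using expectation_pair[OF assms, of "\<lambda>z. (H (fst z) (snd z))\<^sup>2"] H_square_integrable
  by (simp_all add: V_def)

lemma H_W_sym:
  assumes "s \<in> I" "t \<in> I" "\<omega> \<in> space M"
  shows "H (W s \<omega>) (W t \<omega>) = H (W t \<omega>) (W s \<omega>)"
  using assms by (intro H_sym) (auto dest: measurable_space[OF W_measurable])

text \<open>A degenerate kernel at \<open>(W s, W t)\<close> is orthogonal to every function of the sample that does not
  depend on \<open>W t\<close>: integrate over \<open>W t\<close> first.\<close>

lemma degenerate_orthogonal:
  fixes D :: "'b \<Rightarrow> 'b \<Rightarrow> real"
  assumes D[measurable]: "(\<lambda>z. D (fst z) (snd z)) \<in> borel_measurable (\<mu> \<Otimes>\<^sub>M \<mu>)"
    and deg: "AE x in \<mu>. (\<integral>y. D x y \<partial>\<mu>) = 0"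
    and s: "s \<in> I" and t: "t \<in> I" "t \<noteq> s" and J: "J \<subseteq> I" "t \<notin> J"
    and g: "g \<in> borel_measurable (PiM J (\<lambda>_. \<mu>))"
    and int: "integrable M (\<lambda>\<omega>. D (W s \<omega>) (W t \<omega>) * g (\<lambda>i\<in>J. W i \<omega>))"
  shows "(\<integral>\<omega>. D (W s \<omega>) (W t \<omega>) * g (\<lambda>i\<in>J. W i \<omega>) \<partial>M) = 0"
proof -
  let ?K = "insert s J"
  define F where "F = (\<lambda>z. D (fst z s) (snd z t) * g (restrict (fst z) J))"
  have [simp]: "?K \<inter> J = J" by auto
  have [measurable]: "(\<lambda>\<phi>. g (restrict \<phi> J)) \<in> borel_measurable (PiM ?K (\<lambda>_. \<mu>))"
    by (rule measurable_compose[OF measurable_restrict_subset g]) auto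
  have DF: "(\<lambda>z. D (fst z s) (snd z t)) \<in> borel_measurable (PiM ?K (\<lambda>_. \<mu>) \<Otimes>\<^sub>M PiM {t} (\<lambda>_. \<mu>))"
    using measurable_compose[OF measurable_Pair[of "\<lambda>z. fst z s" "PiM ?K (\<lambda>_. \<mu>) \<Otimes>\<^sub>M PiM {t} (\<lambda>_. \<mu>)" \<mu> "\<lambda>z. snd z t" \<mu>] D]
    by simp
  have F: "F \<in> borel_measurable (PiM ?K (\<lambda>_. \<mu>) \<Otimes>\<^sub>M PiM {t} (\<lambda>_. \<mu>))"
    unfolding F_def by (intro borel_measurable_times DF) measurable
  have ind: "S.indep_var (PiM ?K (\<lambda>_. \<mu>)) (\<lambda>\<omega>. \<lambda>i\<in>?K. W i \<omega>) (PiM {t} (\<lambda>_. \<mu>)) (\<lambda>\<omega>. \<lambda>i\<in>{t}. W i \<omega>)"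
    by (rule S.indep_var_restrict[OF indep]) (use s t J in auto)
  have "(\<integral>\<omega>. F (\<lambda>i\<in>?K. W i \<omega>, \<lambda>i\<in>{t}. W i \<omega>) \<partial>M) = 0"
  proof (rule S.expectation_zero_of_fibres[OF ind F])
    show "integrable M (\<lambda>\<omega>. F (\<lambda>i\<in>?K. W i \<omega>, \<lambda>i\<in>{t}. W i \<omega>))"
      using int by (simp add: F_def restrict_restrict)
    have "AE \<omega> in M. (\<integral>y. D (W s \<omega>) y \<partial>\<mu>) = 0"
      by (rule AE_W[OF deg s])
    with AE_space show "AE \<omega> in M. (\<integral>\<omega>'. F (\<lambda>i\<in>?K. W i \<omega>, \<lambda>i\<in>{t}. W i \<omega>') \<partial>M) = 0"
    proof eventually_elim
      case (elim \<omega>)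
      then have [measurable]: "D (W s \<omega>) \<in> borel_measurable \<mu>"
        using measurable_compose[OF measurable_Pair1' D] measurable_space[OF W_measurable[OF s]] by simp
      show ?case
        using elim expectation_W(2)[of "D (W s \<omega>)" t] t by (simp add: F_def)
    qed
  qed
  then show ?thesis by (simp add: F_def restrict_restrict)
qed

lemmas H_orthogonal = degenerate_orthogonal[of H, OF _ AE_H_integral_zero]

text \<open>Two distinct unordered pairs always have an index that occurs in only one of them. By the symmetry
  of \<open>H\<close> it may be taken as the second argument of its factor.\<close>

lemma H_pairs_orthogonal:
  assumes I: "s \<in> I" "t \<in> I" "u \<in> I" "v \<in> I" and ne: "s \<noteq> t" "u \<noteq> v"
    and diff: "{s, t} \<noteq> {u, v}"
  shows "integrable M (\<lambda>\<omega>. H (W s \<omega>) (W t \<omega>) * H (W u \<omega>) (W v \<omega>))"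
    and "(\<integral>\<omega>. H (W s \<omega>) (W t \<omega>) * H (W u \<omega>) (W v \<omega>) \<partial>M) = 0"
proof -
  have [measurable]: "W s \<in> measurable M \<mu>" "W t \<in> measurable M \<mu>" "W u \<in> measurable M \<mu>" "W v \<in> measurable M \<mu>"
    using I by auto
  show int: "integrable M (\<lambda>\<omega>. H (W s \<omega>) (W t \<omega>) * H (W u \<omega>) (W v \<omega>))"
    using I ne by (intro integrable_product_of_squares H_pair) simp_all
  have last_free: "(\<integral>\<omega>. H (W a \<omega>) (W b \<omega>) * H (W u \<omega>) (W v \<omega>) \<partial>M) = 0"
    if "b \<notin> {u, v}" "{a, b} = {s, t}" for a b
  proof -
    have ab: "a \<in> I" "b \<in> I" "b \<noteq> a" using that I ne by (auto simp: doubleton_eq_iff)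
    have int': "integrable M (\<lambda>\<omega>. H (W a \<omega>) (W b \<omega>) * H (W u \<omega>) (W v \<omega>))"
      using that int H_W_sym[OF I(1,2)]
      by (auto simp: doubleton_eq_iff cong: Bochner_Integration.integrable_cong)
    show ?thesis
      using H_orthogonal[OF _ ab, of "{u, v}" "\<lambda>\<phi>. H (\<phi> u) (\<phi> v)"] that I int' by simp
  qed
  from diff ne have "t \<notin> {u, v} \<or> s \<notin> {u, v}" by auto
  then show "(\<integral>\<omega>. H (W s \<omega>) (W t \<omega>) * H (W u \<omega>) (W v \<omega>) \<partial>M) = 0"
  proof
    assume "s \<notin> {u, v}"
    from last_free[OF this, of t] show ?thesis
      using H_W_sym[OF I(1,2)] by (simp add: insert_commute cong: Bochner_Integration.integral_cong)
  qed (use last_free[of t s] in simp)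
qed

lemma k_pair:
  assumes "s \<in> I" "t \<in> I" "s \<noteq> t"
  shows "integrable M (\<lambda>\<omega>. (k (W s \<omega>) (W t \<omega>))\<^sup>2)"
    and "integrable M (\<lambda>\<omega>. k (W s \<omega>) (W t \<omega>))"
    and "(\<integral>\<omega>. k (W s \<omega>) (W t \<omega>) \<partial>M) = mean"
  using expectation_pair[OF assms, of "\<lambda>z. (k (fst z) (snd z))\<^sup>2"] k_square_integrable
    expectation_pair[OF assms, of "\<lambda>z. k (fst z) (snd z)"] k_integrable
  by (simp_all add: mean_def)

text \<open>\<open>V2\<close> is the second moment of \<open>H\<close>: by degeneracy \<open>E H\<^sup>2 = E (H k)\<close>, and integrating over
  \<open>Z\<^sub>3\<close> first shows that \<open>E (k(Z\<^sub>1, Z\<^sub>2) k(Z\<^sub>1, Z\<^sub>3)) = E (k(Z\<^sub>1, Z\<^sub>2) k1(Z\<^sub>1))\<close>.\<close>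

lemma V2_eq_V:
  assumes I: "1 \<in> I" "2 \<in> I" "3 \<in> I"
  shows "V2 M k W = V"
proof -
  have [measurable]: "W 1 \<in> measurable M \<mu>" "W 2 \<in> measurable M \<mu>" "W 3 \<in> measurable M \<mu>"
    using I by auto
  have W_space: "W i \<omega> \<in> space \<mu>" if "i \<in> I" "\<omega> \<in> space M" for i \<omega>
    using that measurable_space[OF W_measurable] by blast
  let ?k = "\<lambda>i j \<omega>. k (W i \<omega>) (W j \<omega>)" and ?p = "\<lambda>i \<omega>. k1 (W i \<omega>)"
    and ?H = "\<lambda>i j \<omega>. H (W i \<omega>) (W j \<omega>)"
  have k2: "integrable M (\<lambda>\<omega>. (?k i j \<omega>)\<^sup>2)" if "i \<in> I" "j \<in> I" "i \<noteq> j" for i j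
    using k_pair[OF that] by simp
  have p2: "integrable M (\<lambda>\<omega>. (?p i \<omega>)\<^sup>2)" if "i \<in> I" for i
    using expectation_W(1)[of "\<lambda>x. (k1 x)\<^sup>2" i] k1_square_integrable that by simp
  have prod: "integrable M (\<lambda>\<omega>. ?k 1 2 \<omega> * ?k 1 3 \<omega>)" "integrable M (\<lambda>\<omega>. ?p 1 \<omega> * ?k 1 2 \<omega>)"
    "integrable M (\<lambda>\<omega>. ?p 2 \<omega> * ?k 1 2 \<omega>)" "integrable M (\<lambda>\<omega>. ?H 1 2 \<omega> * ?p 1 \<omega>)"
    "integrable M (\<lambda>\<omega>. ?H 2 1 \<omega> * ?p 2 \<omega>)" "integrable M (\<lambda>\<omega>. ?H 1 2 \<omega> * ?k 1 2 \<omega>)"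
    "integrable M (?H 1 2)"
    using I S.square_integrable_imp_integrable[OF _ H_pair(1), of 1 2]
    by (auto intro!: integrable_product_of_squares k2 p2 H_pair)
  have deg: "AE x in \<mu>. (\<integral>y. k x y - k1 x \<partial>\<mu>) = 0"
    using AE_k_integrable by eventually_elim (simp add: k1_def prob_space)
  \<comment> \<open>The kernel \<open>k x y - k1 x\<close> is degenerate in \<open>y\<close>, so \<open>k(W\<^sub>1, W\<^sub>3)\<close> may be replaced by
    \<open>k1(W\<^sub>1)\<close> next to a function of \<open>W\<^sub>1\<close> and \<open>W\<^sub>2\<close>.\<close>
  have "(\<integral>\<omega>. (?k 1 3 \<omega> - ?p 1 \<omega>) * ?k 1 2 \<omega> \<partial>M) = 0"
    using degenerate_orthogonal[OF _ deg, of 1 3 "{1, 2}" "\<lambda>\<phi>. k (\<phi> 1) (\<phi> 2)"] I prod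
    by (simp add: algebra_simps)
  then have k123: "(\<integral>\<omega>. ?k 1 2 \<omega> * ?k 1 3 \<omega> \<partial>M) = (\<integral>\<omega>. ?p 1 \<omega> * ?k 1 2 \<omega> \<partial>M)"
    using prod by (simp add: algebra_simps)
  have p12: "(\<integral>\<omega>. ?p 2 \<omega> * ?k 1 2 \<omega> \<partial>M) = (\<integral>\<omega>. ?p 1 \<omega> * ?k 1 2 \<omega> \<partial>M)"
  proof -
    have "(\<integral>\<omega>. ?p 2 \<omega> * ?k 1 2 \<omega> \<partial>M) = (\<integral>\<omega>. ?p 2 \<omega> * ?k 2 1 \<omega> \<partial>M)"
      using W_space I by (intro Bochner_Integration.integral_cong refl) (simp add: k_sym)
    also have "\<dots> = (\<integral>\<omega>. ?p 1 \<omega> * ?k 1 2 \<omega> \<partial>M)"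
      using expectation_pair(2)[of 2 1 "\<lambda>z. k1 (fst z) * k (fst z) (snd z)"]
        expectation_pair(2)[of 1 2 "\<lambda>z. k1 (fst z) * k (fst z) (snd z)"] I by simp
    finally show ?thesis .
  qed
  have H0: "(\<integral>\<omega>. ?H 1 2 \<omega> \<partial>M) = 0"
    using H_orthogonal[of 1 2 "{}" "\<lambda>_. 1"] I prod by simp
  have H1: "(\<integral>\<omega>. ?H 1 2 \<omega> * ?p 1 \<omega> \<partial>M) = 0"
    using H_orthogonal[of 1 2 "{1}" "\<lambda>\<phi>. k1 (\<phi> 1)"] I prod by simp
  have H2': "(\<integral>\<omega>. ?H 2 1 \<omega> * ?p 2 \<omega> \<partial>M) = 0"
    using H_orthogonal[of 2 1 "{2}" "\<lambda>\<phi>. k1 (\<phi> 2)"] I prod by simp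
  have H2: "integrable M (\<lambda>\<omega>. ?H 1 2 \<omega> * ?p 2 \<omega>)" "(\<integral>\<omega>. ?H 1 2 \<omega> * ?p 2 \<omega> \<partial>M) = 0"
    using H2' prod(5) H_W_sym[of 1 2] I
    by (simp_all cong: Bochner_Integration.integral_cong Bochner_Integration.integrable_cong)
  have "V = (\<integral>\<omega>. (?H 1 2 \<omega>)\<^sup>2 \<partial>M)" using H_pair(2)[of 1 2] I by simp
  also have "\<dots> = (\<integral>\<omega>. ?H 1 2 \<omega> * ?k 1 2 \<omega> - ?H 1 2 \<omega> * ?p 1 \<omega> - ?H 1 2 \<omega> * ?p 2 \<omega> + mean * ?H 1 2 \<omega> \<partial>M)"
    by (intro Bochner_Integration.integral_cong refl) (simp add: H_def power2_eq_square algebra_simps)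
  also have "\<dots> = (\<integral>\<omega>. ?H 1 2 \<omega> * ?k 1 2 \<omega> \<partial>M)"
    using prod H2 H0 H1 by simp
  also have "\<dots> = (\<integral>\<omega>. (?k 1 2 \<omega>)\<^sup>2 - ?p 1 \<omega> * ?k 1 2 \<omega> - ?p 2 \<omega> * ?k 1 2 \<omega> + mean * ?k 1 2 \<omega> \<partial>M)"
    by (intro Bochner_Integration.integral_cong refl) (simp add: H_def power2_eq_square algebra_simps)
  also have "\<dots> = (\<integral>\<omega>. (?k 1 2 \<omega>)\<^sup>2 \<partial>M) - (\<integral>\<omega>. ?p 1 \<omega> * ?k 1 2 \<omega> \<partial>M)
      - (\<integral>\<omega>. ?p 2 \<omega> * ?k 1 2 \<omega> \<partial>M) + mean * mean"
    using prod k_pair[of 1 2] I by simp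
  also have "\<dots> = V2 M k W"
    using k_pair[of 1 2] I p12 k123 by (simp add: V2_def power2_eq_square)
  finally show ?thesis by simp
qed

text \<open>This is Pythagoras' theorem for the summands. It needs every unordered pair to be listed at most
  once in \<open>P\<close>, since \<open>(s, t)\<close> and \<open>(t, s)\<close> give the same random variable.\<close>

lemma orthogonal_sum_second_moment:
  assumes P: "finite P" "P \<subseteq> I \<times> I" "\<And>s t. (s, t) \<in> P \<Longrightarrow> s \<noteq> t"
    and unordered: "\<And>s t u v. (s, t) \<in> P \<Longrightarrow> (u, v) \<in> P \<Longrightarrow> {s, t} = {u, v} \<Longrightarrow> (s, t) = (u, v)"
  shows "integrable M (\<lambda>\<omega>. (\<Sum>(s, t)\<in>P. c s t * H (W s \<omega>) (W t \<omega>))\<^sup>2)"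
    and "(\<integral>\<omega>. (\<Sum>(s, t)\<in>P. c s t * H (W s \<omega>) (W t \<omega>))\<^sup>2 \<partial>M) = V * (\<Sum>(s, t)\<in>P. (c s t)\<^sup>2)"
proof -
  let ?h = "\<lambda>p \<omega>. H (W (fst p) \<omega>) (W (snd p) \<omega>)" and ?c = "\<lambda>p. c (fst p) (snd p)"
  have sq: "(\<Sum>(s, t)\<in>P. c s t * H (W s \<omega>) (W t \<omega>))\<^sup>2
      = (\<Sum>p\<in>P. \<Sum>q\<in>P. ?c p * ?c q * (?h p \<omega> * ?h q \<omega>))" for \<omega>
    unfolding case_prod_beta power2_eq_square sum_product by (intro sum.cong refl) simp
  have E: "integrable M (\<lambda>\<omega>. ?h p \<omega> * ?h q \<omega>) \<and> (\<integral>\<omega>. ?h p \<omega> * ?h q \<omega> \<partial>M) = (if p = q then V else 0)"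
    if "p \<in> P" "q \<in> P" for p q
  proof -
    obtain s t u v where pq: "p = (s, t)" "q = (u, v)" by fastforce
    have st: "s \<in> I" "t \<in> I" "s \<noteq> t" and uv: "u \<in> I" "v \<in> I" "u \<noteq> v" using that pq P by auto
    show ?thesis
    proof (cases "p = q")
      case True
      then show ?thesis using H_pair[OF st] pq by (simp add: power2_eq_square)
    next
      case False
      then have "{s, t} \<noteq> {u, v}" using unordered that pq by blast
      from H_pairs_orthogonal[OF st(1,2) uv(1,2) st(3) uv(3) this] False show ?thesis by (auto simp: pq)
    qed
  qed
  show "integrable M (\<lambda>\<omega>. (\<Sum>(s, t)\<in>P. c s t * H (W s \<omega>) (W t \<omega>))\<^sup>2)"
    unfolding sq using E by (intro Bochner_Integration.integrable_sum integrable_mult_right) auto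
  have "(\<integral>\<omega>. (\<Sum>(s, t)\<in>P. c s t * H (W s \<omega>) (W t \<omega>))\<^sup>2 \<partial>M)
      = (\<Sum>p\<in>P. \<Sum>q\<in>P. ?c p * ?c q * (if p = q then V else 0))"
    unfolding sq using E by (subst Bochner_Integration.integral_sum, force intro!: Bochner_Integration.integrable_sum)
      (auto intro!: sum.cong simp: Bochner_Integration.integral_sum)
  also have "\<dots> = (\<Sum>p\<in>P. V * (?c p)\<^sup>2)"
    using P(1) by (intro sum.cong refl) (simp add: if_distrib[of "\<lambda>x. _ * x"] sum.delta' power2_eq_square cong: if_cong)
  finally show "(\<integral>\<omega>. (\<Sum>(s, t)\<in>P. c s t * H (W s \<omega>) (W t \<omega>))\<^sup>2 \<partial>M) = V * (\<Sum>(s, t)\<in>P. (c s t)\<^sup>2)"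
    by (simp add: sum_distrib_left case_prod_beta)
qed

end

section \<open>A weak law for U-statistics of order two\<close>

context iid_sample
begin

text \<open>Only pairs that share an index contribute to the variance; for a given pair \<open>(s, t)\<close> there
  are fewer than \<open>4 N\<close> of them.\<close>

lemma u_statistic_second_moment:
  fixes g :: "'b \<times> 'b \<Rightarrow> real"
  assumes I: "{1..N} \<subseteq> I" and g[measurable]: "g \<in> borel_measurable (\<mu> \<Otimes>\<^sub>M \<mu>)"
    and g2: "integrable (\<mu> \<Otimes>\<^sub>M \<mu>) (\<lambda>z. (g z)\<^sup>2)"
  defines "m \<equiv> (\<integral>z. g z \<partial>(\<mu> \<Otimes>\<^sub>M \<mu>))"
  shows "integrable M (\<lambda>\<omega>. (\<Sum>s=1..N. \<Sum>t\<in>{1..N} - {s}. g (W s \<omega>, W t \<omega>) - m)\<^sup>2)"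
    and "(\<integral>\<omega>. (\<Sum>s=1..N. \<Sum>t\<in>{1..N} - {s}. g (W s \<omega>, W t \<omega>) - m)\<^sup>2 \<partial>M)
      \<le> 4 * (real N)\<^sup>2 * (real N - 1) * (\<integral>z. (g z)\<^sup>2 \<partial>(\<mu> \<Otimes>\<^sub>M \<mu>))"
proof -
  define P where "P = (SIGMA s:{1..N}. {1..N} - {s})"
  define f where "f = (\<lambda>p \<omega>. g (W (fst p) \<omega>, W (snd p) \<omega>) - m)"
  define v where "v = (\<integral>z. (g z)\<^sup>2 \<partial>(\<mu> \<Otimes>\<^sub>M \<mu>))"
  have fin: "finite P" by (simp add: P_def)
  have v0: "v \<ge> 0" by (simp add: v_def)
  have gint: "integrable (\<mu> \<Otimes>\<^sub>M \<mu>) g"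
    by (rule pair.square_integrable_imp_integrable[OF g g2])
  have P: "fst p \<in> I" "snd p \<in> I" "fst p \<noteq> snd p" if "p \<in> P" for p
    using that I by (auto simp: P_def)
  have Wm[measurable]: "W (fst p) \<in> measurable M \<mu>" "W (snd p) \<in> measurable M \<mu>" if "p \<in> P" for p
    using P[OF that] by auto
  have f_meas[measurable]: "f p \<in> borel_measurable M" if "p \<in> P" for p
    unfolding f_def using Wm[OF that] by measurable
  have f_int: "integrable M (f p)" and f_mean: "(\<integral>\<omega>. f p \<omega> \<partial>M) = 0" if "p \<in> P" for p
    using expectation_pair[OF P[OF that] g] gint by (simp_all add: f_def m_def S.prob_space)
  have f2: "integrable M (\<lambda>\<omega>. (f p \<omega>)\<^sup>2)" "(\<integral>\<omega>. (f p \<omega>)\<^sup>2 \<partial>M) \<le> v" if "p \<in> P" for p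
  proof -
    have 1: "integrable M (\<lambda>\<omega>. (g (W (fst p) \<omega>, W (snd p) \<omega>))\<^sup>2)"
      "(\<integral>\<omega>. (g (W (fst p) \<omega>, W (snd p) \<omega>))\<^sup>2 \<partial>M) = v"
      using expectation_pair[OF P[OF that], of "\<lambda>z. (g z)\<^sup>2"] g2 by (simp_all add: v_def)
    have 2: "integrable M (\<lambda>\<omega>. g (W (fst p) \<omega>, W (snd p) \<omega>))"
      "(\<integral>\<omega>. g (W (fst p) \<omega>, W (snd p) \<omega>) \<partial>M) = m"
      using expectation_pair[OF P[OF that] g] gint by (simp_all add: m_def)
    have sq: "(f p \<omega>)\<^sup>2 = (g (W (fst p) \<omega>, W (snd p) \<omega>))\<^sup>2 - 2 * m * g (W (fst p) \<omega>, W (snd p) \<omega>) + m\<^sup>2" for \<omega>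
      by (simp add: f_def power2_diff algebra_simps)
    show "integrable M (\<lambda>\<omega>. (f p \<omega>)\<^sup>2)" unfolding sq using 1 2 by simp
    have "(\<integral>\<omega>. (f p \<omega>)\<^sup>2 \<partial>M) = v - 2 * m * m + m\<^sup>2"
      unfolding sq using 1 2 by (simp add: S.prob_space)
    also have "\<dots> = v - m\<^sup>2" by (simp add: power2_eq_square)
    also have "\<dots> \<le> v" by simp
    finally show "(\<integral>\<omega>. (f p \<omega>)\<^sup>2 \<partial>M) \<le> v" .
  qed
  have ff: "integrable M (\<lambda>\<omega>. f p \<omega> * f q \<omega>)" if "p \<in> P" "q \<in> P" for p q
    using that f2 by (intro integrable_product_of_squares) auto
  have overlap: "(\<integral>\<omega>. f p \<omega> * f q \<omega> \<partial>M) \<le> v" if "p \<in> P" "q \<in> P" for p q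
  proof -
    have "(\<integral>\<omega>. f p \<omega> * f q \<omega> \<partial>M) \<le> (\<integral>\<omega>. ((f p \<omega>)\<^sup>2 + (f q \<omega>)\<^sup>2) / 2 \<partial>M)"
      using that ff f2 sum_squares_bound[of "f p _" "f q _"] by (intro integral_mono) (auto simp: field_simps)
    also have "\<dots> = ((\<integral>\<omega>. (f p \<omega>)\<^sup>2 \<partial>M) + (\<integral>\<omega>. (f q \<omega>)\<^sup>2 \<partial>M)) / 2"
      using that f2 by simp
    also have "\<dots> \<le> v" using f2(2)[OF that(1)] f2(2)[OF that(2)] by simp
    finally show ?thesis .
  qed
  have disjoint: "(\<integral>\<omega>. f p \<omega> * f q \<omega> \<partial>M) = 0"
    if "p \<in> P" "q \<in> P" "fst q \<notin> {fst p, snd p}" "snd q \<notin> {fst p, snd p}" for p q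
  proof -
    let ?g = "\<lambda>p \<phi>. g (\<phi> (fst p), \<phi> (snd p)) - m" and ?A = "{fst p, snd p}" and ?B = "{fst q, snd q}"
    have "S.indep_var borel (\<lambda>\<omega>. ?g p (\<lambda>i\<in>?A. W i \<omega>)) borel (\<lambda>\<omega>. ?g q (\<lambda>i\<in>?B. W i \<omega>))"
      by (rule S.indep_var_coordinates[OF indep]) (use that P in \<open>auto intro!: borel_measurable_diff measurable_compose[OF _ g]\<close>)
    then have "S.indep_var borel (f p) borel (f q)"
      by (simp add: f_def)
    then have "(\<integral>\<omega>. f p \<omega> * f q \<omega> \<partial>M) = (\<integral>\<omega>. f p \<omega> \<partial>M) * (\<integral>\<omega>. f q \<omega> \<partial>M)"
      using f_int that by (intro S.indep_var_lebesgue_integral) auto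
    then show ?thesis using f_mean that by simp
  qed
  have card_overlap: "real (card {q \<in> P. fst q \<in> {fst p, snd p} \<or> snd q \<in> {fst p, snd p}}) \<le> 4 * real N"
    if "p \<in> P" for p
  proof -
    let ?A = "{fst p, snd p}"
    have "{q \<in> P. fst q \<in> ?A \<or> snd q \<in> ?A} \<subseteq> ?A \<times> {1..N} \<union> {1..N} \<times> ?A"
      by (auto simp: P_def)
    then have "card {q \<in> P. fst q \<in> ?A \<or> snd q \<in> ?A} \<le> card (?A \<times> {1..N} \<union> {1..N} \<times> ?A)"
      by (intro card_mono) auto
    also have "\<dots> \<le> card (?A \<times> {1..N}) + card ({1..N} \<times> ?A)" by (rule card_Un_le)
    also have "\<dots> = 2 * card ?A * N" by (simp add: card_cartesian_product)
    also have "\<dots> \<le> 4 * N" using P[OF that] by simp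
    finally show ?thesis by simp
  qed
  have card_P: "real (card P) = real N * (real N - 1)"
    by (cases "N = 0") (simp_all add: P_def of_nat_diff)
  have S: "(\<Sum>s=1..N. \<Sum>t\<in>{1..N} - {s}. g (W s \<omega>, W t \<omega>) - m) = (\<Sum>p\<in>P. f p \<omega>)" for \<omega>
    unfolding P_def f_def by (subst sum.Sigma) (auto simp: case_prod_beta)
  have sq: "(\<Sum>p\<in>P. f p \<omega>)\<^sup>2 = (\<Sum>p\<in>P. \<Sum>q\<in>P. f p \<omega> * f q \<omega>)" for \<omega>
    by (simp add: power2_eq_square sum_product)
  show "integrable M (\<lambda>\<omega>. (\<Sum>s=1..N. \<Sum>t\<in>{1..N} - {s}. g (W s \<omega>, W t \<omega>) - m)\<^sup>2)"
    unfolding S sq using ff by (intro Bochner_Integration.integrable_sum) auto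
  have "(\<integral>\<omega>. (\<Sum>p\<in>P. f p \<omega>)\<^sup>2 \<partial>M) = (\<Sum>p\<in>P. \<Sum>q\<in>P. \<integral>\<omega>. f p \<omega> * f q \<omega> \<partial>M)"
    unfolding sq using ff by (simp add: Bochner_Integration.integral_sum Bochner_Integration.integrable_sum)
  also have "\<dots> \<le> (\<Sum>p\<in>P. \<Sum>q\<in>{q \<in> P. fst q \<in> {fst p, snd p} \<or> snd q \<in> {fst p, snd p}}. v)"
  proof (rule sum_mono)
    fix p assume p: "p \<in> P"
    have "(\<Sum>q\<in>P. \<integral>\<omega>. f p \<omega> * f q \<omega> \<partial>M)
        = (\<Sum>q\<in>{q \<in> P. fst q \<in> {fst p, snd p} \<or> snd q \<in> {fst p, snd p}}. \<integral>\<omega>. f p \<omega> * f q \<omega> \<partial>M)"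
      by (rule sum.mono_neutral_right) (use fin disjoint p in auto)
    also have "\<dots> \<le> (\<Sum>q\<in>{q \<in> P. fst q \<in> {fst p, snd p} \<or> snd q \<in> {fst p, snd p}}. v)"
      using overlap p by (intro sum_mono) auto
    finally show "(\<Sum>q\<in>P. \<integral>\<omega>. f p \<omega> * f q \<omega> \<partial>M) \<le> \<dots>" .
  qed
  also have "\<dots> \<le> (\<Sum>p\<in>P. 4 * real N * v)"
  proof (rule sum_mono)
    fix p assume "p \<in> P"
    from mult_right_mono[OF card_overlap[OF this] v0]
    show "(\<Sum>q\<in>{q \<in> P. fst q \<in> {fst p, snd p} \<or> snd q \<in> {fst p, snd p}}. v) \<le> 4 * real N * v" by simp
  qed
  also have "\<dots> = 4 * (real N)\<^sup>2 * (real N - 1) * v"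
    by (simp add: card_P power2_eq_square)
  finally show "(\<integral>\<omega>. (\<Sum>s=1..N. \<Sum>t\<in>{1..N} - {s}. g (W s \<omega>, W t \<omega>) - m)\<^sup>2 \<partial>M)
      \<le> 4 * (real N)\<^sup>2 * (real N - 1) * v"
    unfolding S .
qed

lemma u_statistic_mean:
  fixes g :: "'b \<times> 'b \<Rightarrow> real"
  assumes I: "{1..N} \<subseteq> I" and g[measurable]: "g \<in> borel_measurable (\<mu> \<Otimes>\<^sub>M \<mu>)"
    and int: "integrable (\<mu> \<Otimes>\<^sub>M \<mu>) g"
  shows "integrable M (\<lambda>\<omega>. \<Sum>s=1..N. \<Sum>t\<in>{1..N} - {s}. g (W s \<omega>, W t \<omega>))"
    and "(\<integral>\<omega>. (\<Sum>s=1..N. \<Sum>t\<in>{1..N} - {s}. g (W s \<omega>, W t \<omega>)) \<partial>M)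
      = real N * (real N - 1) * (\<integral>z. g z \<partial>(\<mu> \<Otimes>\<^sub>M \<mu>))"
proof -
  have E: "integrable M (\<lambda>\<omega>. g (W s \<omega>, W t \<omega>))"
    "(\<integral>\<omega>. g (W s \<omega>, W t \<omega>) \<partial>M) = (\<integral>z. g z \<partial>(\<mu> \<Otimes>\<^sub>M \<mu>))"
    if "s \<in> {1..N}" "t \<in> {1..N} - {s}" for s t
  proof -
    have "s \<in> I" "t \<in> I" "s \<noteq> t" using that I by auto
    note E = expectation_pair[OF this g]
    show "integrable M (\<lambda>\<omega>. g (W s \<omega>, W t \<omega>))" by (rule E(1)[THEN iffD2, OF int])
    show "(\<integral>\<omega>. g (W s \<omega>, W t \<omega>) \<partial>M) = (\<integral>z. g z \<partial>(\<mu> \<Otimes>\<^sub>M \<mu>))" by (rule E(2))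
  qed
  show "integrable M (\<lambda>\<omega>. \<Sum>s=1..N. \<Sum>t\<in>{1..N} - {s}. g (W s \<omega>, W t \<omega>))"
    by (intro Bochner_Integration.integrable_sum E)
  have "(\<integral>\<omega>. (\<Sum>s=1..N. \<Sum>t\<in>{1..N} - {s}. g (W s \<omega>, W t \<omega>)) \<partial>M)
      = (\<Sum>s=1..N. \<integral>\<omega>. (\<Sum>t\<in>{1..N} - {s}. g (W s \<omega>, W t \<omega>)) \<partial>M)"
    by (intro Bochner_Integration.integral_sum Bochner_Integration.integrable_sum E)
  also have "\<dots> = (\<Sum>s=1..N. \<Sum>t\<in>{1..N} - {s}. \<integral>\<omega>. g (W s \<omega>, W t \<omega>) \<partial>M)"
    by (intro sum.cong refl Bochner_Integration.integral_sum E)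
  also have "\<dots> = (\<Sum>s=1..N. \<Sum>t\<in>{1..N} - {s}. \<integral>z. g z \<partial>(\<mu> \<Otimes>\<^sub>M \<mu>))"
    by (intro sum.cong refl E)
  also have "\<dots> = (\<Sum>s=1..N. (real N - 1) * (\<integral>z. g z \<partial>(\<mu> \<Otimes>\<^sub>M \<mu>)))"
    by (rule sum.cong) (auto simp: of_nat_diff)
  finally show "(\<integral>\<omega>. (\<Sum>s=1..N. \<Sum>t\<in>{1..N} - {s}. g (W s \<omega>, W t \<omega>)) \<partial>M)
      = real N * (real N - 1) * (\<integral>z. g z \<partial>(\<mu> \<Otimes>\<^sub>M \<mu>))" by simp
qed

text \<open>Truncate \<open>G\<close> at \<open>N\<close>. The part above \<open>N\<close> has mean at most \<open>E G\<^bsup>1+\<tau>\<^esup> / N\<^bsup>\<tau>\<^esup>\<close>, and the part below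
  has second moment at most \<open>N\<^bsup>1-\<tau>\<^esup> E G\<^bsup>1+\<tau>\<^esup>\<close>, which the variance of the average reduces by a factor of
  order \<open>1 / N\<close>.\<close>

lemma u_statistic_weak_law:
  fixes G :: "'b \<times> 'b \<Rightarrow> real"
  assumes I: "{1..N} \<subseteq> I" and N: "N \<ge> 2" and \<tau>: "0 < \<tau>" "\<tau> \<le> 1" and \<epsilon>: "\<epsilon> > 0"
    and [measurable]: "G \<in> borel_measurable (\<mu> \<Otimes>\<^sub>M \<mu>)" and G0: "\<And>z. G z \<ge> 0"
    and G1: "integrable (\<mu> \<Otimes>\<^sub>M \<mu>) G" "(\<integral>z. G z \<partial>(\<mu> \<Otimes>\<^sub>M \<mu>)) = 1"
    and G\<tau>: "integrable (\<mu> \<Otimes>\<^sub>M \<mu>) (\<lambda>z. G z powr (1 + \<tau>))"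
  defines "U \<equiv> (\<lambda>\<omega>. (\<Sum>s=1..N. \<Sum>t\<in>{1..N} - {s}. G (W s \<omega>, W t \<omega>)) / (real N * (real N - 1)))"
  shows "S.prob {\<omega> \<in> space M. \<bar>U \<omega> - 1\<bar> > \<epsilon>}
    \<le> (32 / \<epsilon>\<^sup>2 + 4 / \<epsilon>) * ((\<integral>z. G z powr (1 + \<tau>) \<partial>(\<mu> \<Otimes>\<^sub>M \<mu>)) / real N powr \<tau>)"
proof -
  define K where "K = (\<integral>z. G z powr (1 + \<tau>) \<partial>(\<mu> \<Otimes>\<^sub>M \<mu>))"
  define \<delta> where "\<delta> = K / real N powr \<tau>"
  define n2 where "n2 = real N * (real N - 1)"
  \<comment> \<open>\<open>g1\<close> and \<open>g2\<close> are the parts of \<open>G\<close> below and above the level \<open>N\<close>; the means satisfy \<open>m1 + m2 = 1\<close>.\<close>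
  define g1 where "g1 = (\<lambda>z. if G z \<le> real N then G z else 0)"
  define g2 where "g2 = (\<lambda>z. G z - g1 z)"
  define m1 m2 where "m1 = (\<integral>z. g1 z \<partial>(\<mu> \<Otimes>\<^sub>M \<mu>))" and "m2 = (\<integral>z. g2 z \<partial>(\<mu> \<Otimes>\<^sub>M \<mu>))"
  define S1 where "S1 = (\<lambda>\<omega>. \<Sum>s=1..N. \<Sum>t\<in>{1..N} - {s}. g1 (W s \<omega>, W t \<omega>) - m1)"
  define S2 where "S2 = (\<lambda>\<omega>. \<Sum>s=1..N. \<Sum>t\<in>{1..N} - {s}. g2 (W s \<omega>, W t \<omega>))"
  have n2: "n2 > 0" using N by (simp add: n2_def)
  have g_meas[measurable]: "g1 \<in> borel_measurable (\<mu> \<Otimes>\<^sub>M \<mu>)" "g2 \<in> borel_measurable (\<mu> \<Otimes>\<^sub>M \<mu>)"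
    by (simp_all add: g1_def g2_def)
  have g10: "g1 z \<ge> 0" and g20: "g2 z \<ge> 0" for z using G0[of z] by (auto simp: g1_def g2_def)
  have g1N: "g1 z \<le> real N" for z by (simp add: g1_def)
  have g1_int: "integrable (\<mu> \<Otimes>\<^sub>M \<mu>) g1"
    using g10 g1N by (intro pair.integrable_const_bound[where B = "real N"]) auto
  have g1_sq: "integrable (\<mu> \<Otimes>\<^sub>M \<mu>) (\<lambda>z. (g1 z)\<^sup>2)"
    by (rule pair.integrable_const_bound[where B = "(real N)\<^sup>2"])
       (use g10 g1N in \<open>auto intro!: AE_I2 power_mono\<close>)
  have g2_int: "integrable (\<mu> \<Otimes>\<^sub>M \<mu>) g2" using G1 g1_int by (simp add: g2_def)
  have m12: "m1 + m2 = 1" using G1 g1_int by (simp add: g2_def m1_def m2_def)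
  have K0: "K \<ge> 0" by (simp add: K_def)
  have tail: "g2 z \<le> G z powr (1 + \<tau>) / real N powr \<tau>" for z
  proof (cases "G z \<le> real N")
    case False
    then have "real N powr \<tau> \<le> G z powr \<tau>" using \<tau> by (intro powr_mono2) auto
    then have "G z * real N powr \<tau> \<le> G z * G z powr \<tau>" using G0[of z] by (intro mult_left_mono)
    also have "\<dots> = G z powr (1 + \<tau>)" using False by (simp add: powr_add)
    finally show ?thesis using False N by (simp add: g1_def g2_def field_simps)
  qed (simp add: g1_def g2_def)
  have m2_le: "m2 \<le> \<delta>"
  proof -
    have "m2 \<le> (\<integral>z. G z powr (1 + \<tau>) / real N powr \<tau> \<partial>(\<mu> \<Otimes>\<^sub>M \<mu>))"
      unfolding m2_def using g2_int G\<tau> tail by (intro integral_mono) auto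
    then show ?thesis using G\<tau> by (simp add: \<delta>_def K_def)
  qed
  have body: "(g1 z)\<^sup>2 \<le> real N powr (1 - \<tau>) * G z powr (1 + \<tau>)" for z
  proof (cases "0 < G z \<and> G z \<le> real N")
    case True
    then have "(g1 z)\<^sup>2 = G z powr (1 - \<tau>) * G z powr (1 + \<tau>)"
      by (simp add: g1_def powr_add[symmetric])
    also have "\<dots> \<le> real N powr (1 - \<tau>) * G z powr (1 + \<tau>)"
      using True \<tau> by (intro mult_right_mono powr_mono2) auto
    finally show ?thesis .
  qed (use G0[of z] in \<open>auto simp: g1_def\<close>)
  have sq_le: "(\<integral>z. (g1 z)\<^sup>2 \<partial>(\<mu> \<Otimes>\<^sub>M \<mu>)) \<le> real N * \<delta>"
  proof -
    have "(\<integral>z. (g1 z)\<^sup>2 \<partial>(\<mu> \<Otimes>\<^sub>M \<mu>)) \<le> (\<integral>z. real N powr (1 - \<tau>) * G z powr (1 + \<tau>) \<partial>(\<mu> \<Otimes>\<^sub>M \<mu>))"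
      using g1_sq G\<tau> body by (intro integral_mono) auto
    also have "\<dots> = real N * \<delta>" using N by (simp add: \<delta>_def K_def powr_diff)
    finally show ?thesis .
  qed
  have S1: "integrable M (\<lambda>\<omega>. (S1 \<omega>)\<^sup>2)"
    "(\<integral>\<omega>. (S1 \<omega>)\<^sup>2 \<partial>M) \<le> 4 * (real N)\<^sup>2 * (real N - 1) * (\<integral>z. (g1 z)\<^sup>2 \<partial>(\<mu> \<Otimes>\<^sub>M \<mu>))"
    unfolding S1_def m1_def by (rule u_statistic_second_moment[OF I g_meas(1) g1_sq])+
  have S2: "integrable M S2" "(\<integral>\<omega>. S2 \<omega> \<partial>M) = n2 * m2"
    unfolding S2_def m2_def n2_def by (rule u_statistic_mean[OF I g_meas(2) g2_int])+
  have S2_nonneg: "S2 \<omega> \<ge> 0" for \<omega> unfolding S2_def by (intro sum_nonneg g20)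
  have split: "U \<omega> - 1 = S1 \<omega> / n2 + (S2 \<omega> / n2 - m2)" for \<omega>
  proof -
    have "(\<Sum>s=1..N. \<Sum>t\<in>{1..N} - {s}. G (W s \<omega>, W t \<omega>)) = S1 \<omega> + S2 \<omega> + (\<Sum>s=1..N. \<Sum>t\<in>{1..N} - {s}. m1)"
      unfolding S1_def S2_def sum.distrib[symmetric] g2_def by (intro sum.cong refl) simp
    also have "(\<Sum>s=1..N. \<Sum>t\<in>{1..N} - {s}. m1) = n2 * m1"
      using N by (simp add: n2_def of_nat_diff)
    finally have "U \<omega> = S1 \<omega> / n2 + S2 \<omega> / n2 + m1"
      using n2 by (simp add: U_def n2_def[symmetric] add_divide_distrib)
    then show ?thesis using m12 by simp
  qed
  let ?X = "\<lambda>\<omega>. (S1 \<omega>)\<^sup>2" and ?Y = "\<lambda>\<omega>. S2 \<omega> / n2 + m2"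
  have m2_nonneg: "m2 \<ge> 0" unfolding m2_def using g20 by simp
  have "{\<omega> \<in> space M. \<bar>U \<omega> - 1\<bar> > \<epsilon>}
      \<subseteq> {\<omega> \<in> space M. ?X \<omega> \<ge> (n2 * \<epsilon> / 2)\<^sup>2} \<union> {\<omega> \<in> space M. ?Y \<omega> \<ge> \<epsilon> / 2}"
  proof safe
    fix \<omega> assume dev: "\<epsilon> < \<bar>U \<omega> - 1\<bar>" and Y: "\<not> \<epsilon> / 2 \<le> ?Y \<omega>"
    have "\<bar>S2 \<omega> / n2 - m2\<bar> \<le> ?Y \<omega>" using S2_nonneg[of \<omega>] m2_nonneg n2 by (auto simp: abs_le_iff)
    then have "\<bar>S1 \<omega> / n2\<bar> \<ge> \<epsilon> / 2" using dev Y unfolding split by linarith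
    then have "\<bar>S1 \<omega>\<bar> \<ge> n2 * \<epsilon> / 2" using n2 by (simp add: field_simps)
    then have "\<bar>n2 * \<epsilon> / 2\<bar> \<le> \<bar>S1 \<omega>\<bar>" using n2 \<epsilon> by simp
    then show "(n2 * \<epsilon> / 2)\<^sup>2 \<le> (S1 \<omega>)\<^sup>2" by (simp only: abs_le_square_iff)
  qed
  moreover have sets: "{\<omega> \<in> space M. ?X \<omega> \<ge> (n2 * \<epsilon> / 2)\<^sup>2} \<in> sets M" "{\<omega> \<in> space M. ?Y \<omega> \<ge> \<epsilon> / 2} \<in> sets M"
    using borel_measurable_integrable[OF S1(1)] borel_measurable_integrable[OF S2(1)] by measurable
  ultimately have "S.prob {\<omega> \<in> space M. \<bar>U \<omega> - 1\<bar> > \<epsilon>}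
      \<le> S.prob ({\<omega> \<in> space M. ?X \<omega> \<ge> (n2 * \<epsilon> / 2)\<^sup>2} \<union> {\<omega> \<in> space M. ?Y \<omega> \<ge> \<epsilon> / 2})"
    by (intro S.finite_measure_mono) auto
  also have "\<dots> \<le> S.prob {\<omega> \<in> space M. ?X \<omega> \<ge> (n2 * \<epsilon> / 2)\<^sup>2} + S.prob {\<omega> \<in> space M. ?Y \<omega> \<ge> \<epsilon> / 2}"
    by (rule measure_Un_le) (use sets in auto)
  also have "S.prob {\<omega> \<in> space M. ?X \<omega> \<ge> (n2 * \<epsilon> / 2)\<^sup>2} \<le> 32 / \<epsilon>\<^sup>2 * \<delta>"
  proof -
    have "S.prob {\<omega> \<in> space M. ?X \<omega> \<ge> (n2 * \<epsilon> / 2)\<^sup>2} \<le> (\<integral>\<omega>. ?X \<omega> \<partial>M) / (n2 * \<epsilon> / 2)\<^sup>2"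
      using S1 n2 \<epsilon> by (intro integral_Markov_inequality_measure[where A = "{}"]) auto
    also have "\<dots> \<le> (4 * (real N)\<^sup>2 * (real N - 1) * (real N * \<delta>)) / (n2 * \<epsilon> / 2)\<^sup>2"
      using N by (intro divide_right_mono order_trans[OF S1(2)] mult_left_mono sq_le) auto
    also have "\<dots> = 16 * (real N / (real N - 1)) / \<epsilon>\<^sup>2 * \<delta>"
      using N \<epsilon> by (simp add: n2_def divide_simps power2_eq_square)
    also have "\<dots> \<le> 16 * 2 / \<epsilon>\<^sup>2 * \<delta>"
      using N K0 by (intro mult_right_mono divide_right_mono mult_left_mono) (auto simp: \<delta>_def field_simps)
    finally show ?thesis by simp
  qed
  also have "S.prob {\<omega> \<in> space M. ?Y \<omega> \<ge> \<epsilon> / 2} \<le> 4 / \<epsilon> * \<delta>"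
  proof -
    have "S.prob {\<omega> \<in> space M. ?Y \<omega> \<ge> \<epsilon> / 2} \<le> (\<integral>\<omega>. ?Y \<omega> \<partial>M) / (\<epsilon> / 2)"
      using S2 n2 \<epsilon> S2_nonneg m2_nonneg
      by (intro integral_Markov_inequality_measure[where A = "{}"]) auto
    also have "(\<integral>\<omega>. ?Y \<omega> \<partial>M) = 2 * m2" using S2 n2 by (simp add: S.prob_space)
    also have "2 * m2 / (\<epsilon> / 2) \<le> 4 / \<epsilon> * \<delta>" using m2_le \<epsilon> by (simp add: divide_simps)
    finally show ?thesis .
  qed
  finally show ?thesis by (simp add: \<delta>_def K_def algebra_simps)
qed

end

section \<open>Concentration of the variance estimator\<close>

text \<open>The estimator divides by \<open>N (N - 3)\<close>, while the average of \<open>H\<^sup>2\<close> runs over \<open>N (N - 1)\<close> pairs.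
  The ratio of the two counts is at most \<open>2\<close> and differs from \<open>1\<close> by \<open>2 / (N - 3)\<close>.\<close>

lemma deviation_of_normalised_estimator:
  fixes N :: nat and U D v :: real
  assumes N: "N \<ge> 5"
    and v: "v = (real N - 1) / (real N - 3) * U + D"
  shows "\<bar>v - 1\<bar> \<le> 2 * \<bar>U - 1\<bar> + 2 / (real N - 3) + \<bar>D\<bar>"
proof -
  have N3: "real N - 3 > 0" using N by simp
  have tri: "\<bar>x + y + z\<bar> \<le> \<bar>x\<bar> + \<bar>y\<bar> + \<bar>z\<bar>" for x y z :: real by linarith
  have "v - 1 = (real N - 1) / (real N - 3) * (U - 1) + 2 / (real N - 3) + D"
  proof -
    have "(real N - 1) / (real N - 3) = 1 + 2 / (real N - 3)" using N3 by (simp add: field_simps)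
    then show ?thesis unfolding v by (simp only:) (simp add: algebra_simps diff_divide_distrib)
  qed
  then have "\<bar>v - 1\<bar> \<le> \<bar>(real N - 1) / (real N - 3) * (U - 1)\<bar> + \<bar>2 / (real N - 3)\<bar> + \<bar>D\<bar>"
    using tri by metis
  also have "\<bar>(real N - 1) / (real N - 3) * (U - 1)\<bar> \<le> 2 * \<bar>U - 1\<bar>"
    unfolding abs_mult using N N3 by (intro mult_right_mono) (auto simp: field_simps)
  also have "\<bar>2 / (real N - 3)\<bar> = 2 / (real N - 3)" using N3 by simp
  finally show ?thesis by simp
qed

context iid_sample
begin

text \<open>The array vanishes outside \<open>{1..N}\<close> as well, since the symmetry of \<open>H\<close> is known only for values of
  sample variables, while the centring identity asks for an array that is symmetric everywhere.\<close>

definition H_array :: "nat \<Rightarrow> 'a \<Rightarrow> nat \<Rightarrow> nat \<Rightarrow> real" where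
  "H_array N \<omega> s t =
     (if s \<in> {1..N} \<and> t \<in> {1..N} \<and> s \<noteq> t then H (W s \<omega>) (W t \<omega>) else 0)"

lemma row_sums_second_moment:
  assumes I: "{1..N} \<subseteq> I"
  shows "integrable M (\<lambda>\<omega>. \<Sum>s=1..N. (row_sum N (H_array N \<omega>) s)\<^sup>2)"
    and "(\<integral>\<omega>. (\<Sum>s=1..N. (row_sum N (H_array N \<omega>) s)\<^sup>2) \<partial>M) = real N * (real N - 1) * V"
proof -
  have E: "integrable M (\<lambda>\<omega>. (row_sum N (H_array N \<omega>) s)\<^sup>2)"
    "(\<integral>\<omega>. (row_sum N (H_array N \<omega>) s)\<^sup>2 \<partial>M) = (real N - 1) * V" if s: "s \<in> {1..N}" for s
  proof -
    let ?P = "{s} \<times> ({1..N} - {s})"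
    have row: "row_sum N (H_array N \<omega>) s = (\<Sum>(s, t)\<in>?P. 1 * H (W s \<omega>) (W t \<omega>))" for \<omega>
    proof -
      have "row_sum N (H_array N \<omega>) s = (\<Sum>t\<in>{1..N} - {s}. H_array N \<omega> s t)"
        using sum_remove_index[OF s, of "H_array N \<omega> s"] by (simp add: row_sum_def H_array_def)
      also have "\<dots> = (\<Sum>t\<in>{1..N} - {s}. H (W s \<omega>) (W t \<omega>))"
        by (rule sum.cong) (use s in \<open>auto simp: H_array_def\<close>)
      also have "\<dots> = (\<Sum>(s, t)\<in>?P. 1 * H (W s \<omega>) (W t \<omega>))"
        by (simp add: sum.cartesian_product[symmetric])
      finally show ?thesis .
    qed
    have P: "finite ?P" "?P \<subseteq> I \<times> I" using s I by auto
    note moments = orthogonal_sum_second_moment[OF P, where c = "\<lambda>_ _. 1"]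
    show "integrable M (\<lambda>\<omega>. (row_sum N (H_array N \<omega>) s)\<^sup>2)"
      unfolding row by (rule moments(1)) (auto simp: doubleton_eq_iff)
    have "(\<integral>\<omega>. (row_sum N (H_array N \<omega>) s)\<^sup>2 \<partial>M) = V * (\<Sum>(s, t)\<in>?P. (1::real)\<^sup>2)"
      unfolding row by (rule moments(2)) (auto simp: doubleton_eq_iff)
    also have "(\<Sum>(s, t)\<in>?P. (1::real)\<^sup>2) = real (card ?P)" by (simp add: case_prod_beta)
    also have "\<dots> = real N - 1" using s by (simp add: card_cartesian_product of_nat_diff)
    finally show "(\<integral>\<omega>. (row_sum N (H_array N \<omega>) s)\<^sup>2 \<partial>M) = (real N - 1) * V" by simp
  qed
  show "integrable M (\<lambda>\<omega>. \<Sum>s=1..N. (row_sum N (H_array N \<omega>) s)\<^sup>2)"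
    by (intro Bochner_Integration.integrable_sum E)
  have "(\<integral>\<omega>. (\<Sum>s=1..N. (row_sum N (H_array N \<omega>) s)\<^sup>2) \<partial>M)
      = (\<Sum>s=1..N. \<integral>\<omega>. (row_sum N (H_array N \<omega>) s)\<^sup>2 \<partial>M)"
    by (intro Bochner_Integration.integral_sum E)
  also have "\<dots> = (\<Sum>s=1..N. (real N - 1) * V)" by (intro sum.cong refl E)
  finally show "(\<integral>\<omega>. (\<Sum>s=1..N. (row_sum N (H_array N \<omega>) s)\<^sup>2) \<partial>M) = real N * (real N - 1) * V"
    by simp
qed

text \<open>Up to a factor tending to \<open>1\<close>, the estimator is the average of \<open>H\<^sup>2\<close> over pairs, corrected by the
  squares of the row sums and of the total. These are non-negative, and by degeneracy their
  contributions have means of order \<open>V / N\<close>, so Markov's inequality suffices for them.\<close>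

lemma estimator_deviation:
  assumes I: "{1..N} \<subseteq> I" and N: "N \<ge> 5" and diag: "\<And>x. x \<in> space \<mu> \<Longrightarrow> k x x = a0"
    and V: "V > 0" and \<tau>: "0 < \<tau>" "\<tau> \<le> 1" and \<epsilon>: "\<epsilon> > 0" and N\<epsilon>: "2 / (real N - 3) \<le> \<epsilon> / 3"
    and mom: "integrable (\<mu> \<Otimes>\<^sub>M \<mu>) (\<lambda>z. \<bar>k (fst z) (snd z) - mean\<bar> powr (2 + 2 * \<tau>))"
  defines "v \<equiv> (\<lambda>\<omega>. 1 / (real N * (real N - 3))
        * (\<Sum>s=1..N. \<Sum>t\<in>{1..N} - {s}. (A_star N (\<lambda>s t. k (W s \<omega>) (W t \<omega>)) s t)\<^sup>2)
      - a0\<^sup>2 / ((real N - 1) * (real N - 3)))"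
  shows "S.prob {\<omega> \<in> space M. \<bar>v \<omega> / V - 1\<bar> > \<epsilon>}
    \<le> (1152 / \<epsilon>\<^sup>2 + 24 / \<epsilon>) * (3 powr (3 + 2 * \<tau>)
        * ((\<integral>z. \<bar>k (fst z) (snd z) - mean\<bar> powr (2 + 2 * \<tau>) \<partial>(\<mu> \<Otimes>\<^sub>M \<mu>))
          / (real N powr \<tau> * V powr (1 + \<tau>))))
      + 9 * real N / (\<epsilon> * ((real N - 2) * (real N - 3)))"
proof -
  define n where "n = real N"
  have n: "n \<ge> 5" using N by (simp add: n_def)
  let ?e = "H_array N" and ?T = "\<lambda>\<omega>. \<Sum>s=1..N. row_sum N (H_array N \<omega>) s"
  define R where "R = (\<lambda>\<omega>. \<Sum>s=1..N. (row_sum N (H_array N \<omega>) s)\<^sup>2)"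
  define G where "G = (\<lambda>z. (H (fst z) (snd z))\<^sup>2 / V)"
  define U where "U = (\<lambda>\<omega>. (\<Sum>s=1..N. \<Sum>t\<in>{1..N} - {s}. G (W s \<omega>, W t \<omega>)) / (real N * (real N - 1)))"
  \<comment> \<open>\<open>D\<close> collects the row-sum and total corrections, divided by \<open>V\<close>. Since the square of the
    total is at most \<open>N R\<close>, the correction is at most \<open>c R\<close>.\<close>
  define D where "D = (\<lambda>\<omega>. 1 / (n * (n - 3) * V) * ((?T \<omega>)\<^sup>2 / ((n - 1) * (n - 2)) - 2 / (n - 2) * R \<omega>))"
  define c where "c = 1 / (n * (n - 3) * V) * (n / ((n - 1) * (n - 2)) + 2 / (n - 2))"
  have R0: "R \<omega> \<ge> 0" for \<omega> unfolding R_def by (intro sum_nonneg) simp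
  have W_space: "W i \<omega> \<in> space \<mu>" if "\<omega> \<in> space M" "i \<in> {1..N}" for \<omega> i
    using that I measurable_space[OF W_measurable] by blast
  have decomp: "v \<omega> / V = (real N - 1) / (real N - 3) * U \<omega> + D \<omega>" if \<omega>: "\<omega> \<in> space M" for \<omega>
  proof -
    have "v \<omega> = 1 / (n * (n - 3)) * ((\<Sum>s=1..N. \<Sum>t\<in>{1..N} - {s}. (?e \<omega> s t)\<^sup>2)
        - 2 / (n - 2) * R \<omega> + (?T \<omega>)\<^sup>2 / ((n - 1) * (n - 2)))"
      unfolding v_def n_def R_def
    proof (rule bias_corrected_sum_of_squares)
      show "?e \<omega> s t = ?e \<omega> t s" for s t
        using W_space[OF \<omega>] by (auto simp: H_array_def intro: H_sym)
      show "k (W s \<omega>) (W s \<omega>) = a0" if "s \<in> {1..N}" for s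
        using diag W_space[OF \<omega> that] by simp
      show "k (W s \<omega>) (W t \<omega>) = ?e \<omega> s t + (k1 (W s \<omega>) - mean / 2) + (k1 (W t \<omega>) - mean / 2)"
        if "s \<in> {1..N}" "t \<in> {1..N}" "s \<noteq> t" for s t
        using that by (simp add: H_array_def H_def)
    qed (use N in \<open>auto simp: H_array_def\<close>)
    also have "(\<Sum>s=1..N. \<Sum>t\<in>{1..N} - {s}. (?e \<omega> s t)\<^sup>2)
        = (\<Sum>s=1..N. \<Sum>t\<in>{1..N} - {s}. V * G (W s \<omega>, W t \<omega>))"
      using V by (intro sum.cong refl) (auto simp: H_array_def G_def)
    also have "\<dots> = V * (\<Sum>s=1..N. \<Sum>t\<in>{1..N} - {s}. G (W s \<omega>, W t \<omega>))"
      by (simp only: sum_distrib_left)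
    also have "(\<Sum>s=1..N. \<Sum>t\<in>{1..N} - {s}. G (W s \<omega>, W t \<omega>)) = n * (n - 1) * U \<omega>"
      using n by (simp add: U_def n_def)
    finally have "v \<omega> = 1 / (n * (n - 3)) * (V * (n * (n - 1) * U \<omega>)
        - 2 / (n - 2) * R \<omega> + (?T \<omega>)\<^sup>2 / ((n - 1) * (n - 2)))" .
    moreover have "1 / (n * (n - 3)) * (V * (n * (n - 1) * u) - y + x) / V
        = (n - 1) / (n - 3) * u + 1 / (n * (n - 3) * V) * (x - y)" for u x y
      using n V by (simp add: divide_simps)
    ultimately show ?thesis unfolding D_def n_def[symmetric] by simp
  qed
  have c0: "c \<ge> 0" using n V by (simp add: c_def)
  have D_le: "\<bar>D \<omega>\<bar> \<le> c * R \<omega>" for \<omega>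
  proof -
    have T: "(?T \<omega>)\<^sup>2 \<le> n * R \<omega>"
      using Cauchy_Schwarz_ineq_sum[of "\<lambda>_. 1" "row_sum N (?e \<omega>)" "{1..N}"] by (simp add: n_def R_def)
    let ?x = "(?T \<omega>)\<^sup>2 / ((n - 1) * (n - 2))" and ?y = "2 / (n - 2) * R \<omega>"
    have "0 \<le> ?x" "?x \<le> n * R \<omega> / ((n - 1) * (n - 2))" "0 \<le> ?y"
      using n R0 T by (auto intro!: divide_right_mono)
    then have "\<bar>?x - ?y\<bar> \<le> n * R \<omega> / ((n - 1) * (n - 2)) + ?y" by linarith
    then have "\<bar>D \<omega>\<bar> \<le> 1 / (n * (n - 3) * V) * (n * R \<omega> / ((n - 1) * (n - 2)) + ?y)"
      unfolding D_def abs_mult using n V by (intro mult_mono) auto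
    also have "\<dots> = c * R \<omega>" by (simp add: c_def algebra_simps)
    finally show ?thesis .
  qed
  have R: "integrable M R" "(\<integral>\<omega>. R \<omega> \<partial>M) = n * (n - 1) * V"
    unfolding R_def n_def by (rule row_sums_second_moment[OF I])+
  have G_meas[measurable]: "G \<in> borel_measurable (\<mu> \<Otimes>\<^sub>M \<mu>)" unfolding G_def by measurable
  have G0: "G z \<ge> 0" for z using V by (simp add: G_def)
  have G1: "integrable (\<mu> \<Otimes>\<^sub>M \<mu>) G" "(\<integral>z. G z \<partial>(\<mu> \<Otimes>\<^sub>M \<mu>)) = 1"
    using H_square_integrable V by (simp_all add: G_def[abs_def] V_def)
  have G_powr: "G z powr (1 + \<tau>) = \<bar>H (fst z) (snd z)\<bar> powr (2 + 2 * \<tau>) / V powr (1 + \<tau>)" for z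
  proof -
    have "(H (fst z) (snd z))\<^sup>2 = \<bar>H (fst z) (snd z)\<bar> powr 2" by simp
    then show ?thesis
      using V unfolding G_def by (simp add: powr_divide powr_powr distrib_left del: powr_numeral)
  qed
  have q: "2 + 2 * \<tau> > 1" using \<tau> by simp
  define K where "K = (\<integral>z. \<bar>k (fst z) (snd z) - mean\<bar> powr (2 + 2 * \<tau>) \<partial>(\<mu> \<Otimes>\<^sub>M \<mu>))"
  have G\<tau>: "integrable (\<mu> \<Otimes>\<^sub>M \<mu>) (\<lambda>z. G z powr (1 + \<tau>))"
    unfolding G_powr using H_moment_le(1)[OF q mom] by simp
  have G\<tau>_le: "(\<integral>z. G z powr (1 + \<tau>) \<partial>(\<mu> \<Otimes>\<^sub>M \<mu>)) / n powr \<tau>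
      \<le> 3 powr (3 + 2 * \<tau>) * (K / (n powr \<tau> * V powr (1 + \<tau>)))"
  proof -
    have "(\<integral>z. \<bar>H (fst z) (snd z)\<bar> powr (2 + 2 * \<tau>) \<partial>(\<mu> \<Otimes>\<^sub>M \<mu>)) \<le> 3 powr (3 + 2 * \<tau>) * K"
      using H_moment_le(2)[OF q mom] by (simp add: K_def)
    then have "(\<integral>z. \<bar>H (fst z) (snd z)\<bar> powr (2 + 2 * \<tau>) \<partial>(\<mu> \<Otimes>\<^sub>M \<mu>)) / V powr (1 + \<tau>) / n powr \<tau>
        \<le> 3 powr (3 + 2 * \<tau>) * K / V powr (1 + \<tau>) / n powr \<tau>"
      by (intro divide_right_mono) auto
    then show ?thesis unfolding G_powr by (simp add: mult.commute)
  qed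
  have weak_law: "S.prob {\<omega> \<in> space M. \<bar>U \<omega> - 1\<bar> > \<epsilon> / 6}
      \<le> (32 / (\<epsilon> / 6)\<^sup>2 + 4 / (\<epsilon> / 6)) * ((\<integral>z. G z powr (1 + \<tau>) \<partial>(\<mu> \<Otimes>\<^sub>M \<mu>)) / n powr \<tau>)"
    unfolding U_def n_def
    by (rule u_statistic_weak_law[OF I _ \<tau> _ G_meas G0 G1 G\<tau>]) (use N \<epsilon> in auto)
  have U_meas: "U \<in> borel_measurable M"
    using borel_measurable_integrable[OF u_statistic_mean(1)[OF I G_meas G1(1)]]
    unfolding U_def by measurable
  have "{\<omega> \<in> space M. \<bar>v \<omega> / V - 1\<bar> > \<epsilon>}
      \<subseteq> {\<omega> \<in> space M. \<bar>U \<omega> - 1\<bar> > \<epsilon> / 6} \<union> {\<omega> \<in> space M. c * R \<omega> \<ge> \<epsilon> / 3}"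
  proof safe
    fix \<omega> assume \<omega>: "\<omega> \<in> space M" "\<epsilon> < \<bar>v \<omega> / V - 1\<bar>" "\<not> \<epsilon> / 3 \<le> c * R \<omega>"
    have "\<epsilon> / 6 < y"
      if "\<epsilon> < x" "x \<le> 2 * y + z + w" "w \<le> r" "z \<le> \<epsilon> / 3" "\<not> \<epsilon> / 3 \<le> r" for x y z w r :: real
      using that by linarith
    from this[OF \<omega>(2) deviation_of_normalised_estimator[OF N decomp[OF \<omega>(1)]] D_le N\<epsilon> \<omega>(3)]
    show "\<epsilon> / 6 < \<bar>U \<omega> - 1\<bar>" .
  qed
  moreover have sets: "{\<omega> \<in> space M. \<bar>U \<omega> - 1\<bar> > \<epsilon> / 6} \<in> sets M" "{\<omega> \<in> space M. c * R \<omega> \<ge> \<epsilon> / 3} \<in> sets M"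
    using U_meas borel_measurable_integrable[OF R(1)] by measurable
  ultimately have "S.prob {\<omega> \<in> space M. \<bar>v \<omega> / V - 1\<bar> > \<epsilon>}
      \<le> S.prob ({\<omega> \<in> space M. \<bar>U \<omega> - 1\<bar> > \<epsilon> / 6} \<union> {\<omega> \<in> space M. c * R \<omega> \<ge> \<epsilon> / 3})"
    by (intro S.finite_measure_mono) auto
  also have "\<dots> \<le> S.prob {\<omega> \<in> space M. \<bar>U \<omega> - 1\<bar> > \<epsilon> / 6} + S.prob {\<omega> \<in> space M. c * R \<omega> \<ge> \<epsilon> / 3}"
    by (rule measure_Un_le) (use sets in auto)
  also have "S.prob {\<omega> \<in> space M. \<bar>U \<omega> - 1\<bar> > \<epsilon> / 6}
      \<le> (1152 / \<epsilon>\<^sup>2 + 24 / \<epsilon>) * (3 powr (3 + 2 * \<tau>) * (K / (n powr \<tau> * V powr (1 + \<tau>))))"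
  proof -
    have "32 / (\<epsilon> / 6)\<^sup>2 + 4 / (\<epsilon> / 6) = 1152 / \<epsilon>\<^sup>2 + 24 / \<epsilon>" by (simp add: power_divide)
    with weak_law have "S.prob {\<omega> \<in> space M. \<bar>U \<omega> - 1\<bar> > \<epsilon> / 6}
        \<le> (1152 / \<epsilon>\<^sup>2 + 24 / \<epsilon>) * ((\<integral>z. G z powr (1 + \<tau>) \<partial>(\<mu> \<Otimes>\<^sub>M \<mu>)) / n powr \<tau>)" by simp
    also have "\<dots> \<le> (1152 / \<epsilon>\<^sup>2 + 24 / \<epsilon>) * (3 powr (3 + 2 * \<tau>) * (K / (n powr \<tau> * V powr (1 + \<tau>))))"
      using \<epsilon> by (intro mult_left_mono G\<tau>_le) auto
    finally show ?thesis .
  qed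
  also have "S.prob {\<omega> \<in> space M. c * R \<omega> \<ge> \<epsilon> / 3} \<le> 9 * n / (\<epsilon> * ((n - 2) * (n - 3)))"
  proof -
    have "S.prob {\<omega> \<in> space M. c * R \<omega> \<ge> \<epsilon> / 3} \<le> (\<integral>\<omega>. c * R \<omega> \<partial>M) / (\<epsilon> / 3)"
      using R c0 R0 \<epsilon> by (intro integral_Markov_inequality_measure[where A = "{}"]) auto
    also have "(\<integral>\<omega>. c * R \<omega> \<partial>M) = (3 * n - 2) / ((n - 2) * (n - 3))"
      using R n V by (simp add: c_def divide_simps)
    also have "\<dots> \<le> 3 * n / ((n - 2) * (n - 3))" using n by (intro divide_right_mono) auto
    finally show ?thesis using \<epsilon> by (simp add: divide_right_mono mult_ac)
  qed
  finally show ?thesis by (simp add: n_def K_def)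
qed

end

section \<open>The variance of the Hoeffding projection\<close>

context pair_kernel
begin

text \<open>The one-point projections and the mean in \<open>h_core\<close> recombine to the double centring, since
  both samples have the law \<open>\<mu>\<close>: the three projected kernels are multiples of the one kernel \<open>H\<close>.\<close>

lemma integral_h_core:
  assumes x: "x \<in> space \<mu>" "y \<in> space \<mu>" "integrable \<mu> (k x)" "integrable \<mu> (k y)"
  shows "(\<integral>z. h_core k x y (fst z) (snd z) \<partial>(\<mu> \<Otimes>\<^sub>M \<mu>)) = - H x y"
    and "(\<integral>z. h_core k (fst z) (snd z) x y \<partial>(\<mu> \<Otimes>\<^sub>M \<mu>)) = - H x y"
    and "(\<integral>z. h_core k x (fst z) y (snd z) \<partial>(\<mu> \<Otimes>\<^sub>M \<mu>)) = H x y / 2"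
proof -
  have [measurable]: "k x \<in> borel_measurable \<mu>" "k y \<in> borel_measurable \<mu>" using x by auto
  have int: "integrable (\<mu> \<Otimes>\<^sub>M \<mu>) (\<lambda>z. k x (fst z))" "integrable (\<mu> \<Otimes>\<^sub>M \<mu>) (\<lambda>z. k x (snd z))"
    "integrable (\<mu> \<Otimes>\<^sub>M \<mu>) (\<lambda>z. k y (fst z))" "integrable (\<mu> \<Otimes>\<^sub>M \<mu>) (\<lambda>z. k y (snd z))"
    using x by (simp_all add: coordinate_integral)
  have eq: "(\<integral>z. k x (fst z) \<partial>(\<mu> \<Otimes>\<^sub>M \<mu>)) = k1 x" "(\<integral>z. k x (snd z) \<partial>(\<mu> \<Otimes>\<^sub>M \<mu>)) = k1 x"
    "(\<integral>z. k y (fst z) \<partial>(\<mu> \<Otimes>\<^sub>M \<mu>)) = k1 y" "(\<integral>z. k y (snd z) \<partial>(\<mu> \<Otimes>\<^sub>M \<mu>)) = k1 y"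
    by (simp_all add: coordinate_integral k1_def)
  have sym: "k (fst z) x = k x (fst z)" "k (snd z) x = k x (snd z)"
    "k (fst z) y = k y (fst z)" "k (snd z) y = k y (snd z)" if "z \<in> space (\<mu> \<Otimes>\<^sub>M \<mu>)" for z
    using that x by (auto simp: space_pair_measure intro: k_sym)
  note facts = int eq k_integrable mean_def[symmetric] pair.prob_space
  show "(\<integral>z. h_core k x y (fst z) (snd z) \<partial>(\<mu> \<Otimes>\<^sub>M \<mu>)) = - H x y"
    unfolding h_core_def using facts by (simp add: H_def)
  have "(\<integral>z. h_core k (fst z) (snd z) x y \<partial>(\<mu> \<Otimes>\<^sub>M \<mu>)) = (\<integral>z. h_core k x y (fst z) (snd z) \<partial>(\<mu> \<Otimes>\<^sub>M \<mu>))"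
    by (intro Bochner_Integration.integral_cong refl) (simp add: h_core_def sym)
  then show "(\<integral>z. h_core k (fst z) (snd z) x y \<partial>(\<mu> \<Otimes>\<^sub>M \<mu>)) = - H x y"
    by (simp add: \<open>(\<integral>z. h_core k x y (fst z) (snd z) \<partial>(\<mu> \<Otimes>\<^sub>M \<mu>)) = - H x y\<close>)
  have "(\<integral>z. h_core k x (fst z) y (snd z) \<partial>(\<mu> \<Otimes>\<^sub>M \<mu>))
      = (\<integral>z. 1 / 2 * (k x y + k x (snd z) + k y (fst z) + k (fst z) (snd z))
          - k x (fst z) - k y (snd z) \<partial>(\<mu> \<Otimes>\<^sub>M \<mu>))"
    by (intro Bochner_Integration.integral_cong refl) (simp add: h_core_def sym)
  also have "\<dots> = H x y / 2" using facts by (simp add: H_def field_simps)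
  finally show "(\<integral>z. h_core k x (fst z) y (snd z) \<partial>(\<mu> \<Otimes>\<^sub>M \<mu>)) = H x y / 2" .
qed

end

lemma sum_ordered_pairs:
  fixes f :: "nat \<Rightarrow> nat \<Rightarrow> real"
  shows "(\<Sum>j=1..n. \<Sum>i=1..<j. f i j) = (\<Sum>(i, j)\<in>{(i, j). 1 \<le> i \<and> i < j \<and> j \<le> n}. f i j)"
proof -
  have "(\<Sum>j=1..n. \<Sum>i=1..<j. f i j) = (\<Sum>(j, i)\<in>(SIGMA j:{1..n}. {1..<j}). f i j)"
    by (simp add: sum.Sigma)
  also have "\<dots> = (\<Sum>(i, j)\<in>{(i, j). 1 \<le> i \<and> i < j \<and> j \<le> n}. f i j)"
    by (rule sum.reindex_bij_witness[of _ "\<lambda>(i, j). (j, i)" "\<lambda>(j, i). (i, j)"]) auto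
  finally show ?thesis .
qed

lemma card_ordered_pairs:
  "real (card {(i, j). 1 \<le> i \<and> i < j \<and> j \<le> n}) = real n * (real n - 1) / 2"
proof -
  have "real (card {(i, j). 1 \<le> i \<and> i < j \<and> j \<le> n})
      = (\<Sum>(i, j)\<in>{(i, j). 1 \<le> i \<and> i < j \<and> j \<le> n}. 1)" by (simp add: case_prod_beta)
  also have "\<dots> = (\<Sum>j=1..n. \<Sum>i=1..<j. (1::real))" by (rule sum_ordered_pairs[symmetric])
  also have "\<dots> = (\<Sum>j=1..n. real j - 1)" by (intro sum.cong refl) (auto simp: of_nat_diff)
  also have "\<dots> = real n * (real n - 1) / 2" by (induction n) (simp_all add: field_simps)
  finally show ?thesis .
qed

lemma finite_ordered_pairs: "finite {(i, j). 1 \<le> i \<and> i < j \<and> j \<le> (n::nat)}"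
  by (rule finite_subset[of _ "{1..n} \<times> {1..n}"]) auto

lemma real_choose_2: "n \<ge> 1 \<Longrightarrow> real (n choose 2) = real n * (real n - 1) / 2"
  by (simp add: choose_two real_of_nat_div of_nat_diff)

context iid_sample
begin

text \<open>The ordered pairs \<open>s < t\<close> of pooled indices split into the pairs within the first sample, the
  mixed pairs and the pairs within the second sample; the corresponding summands are pairwise
  orthogonal.\<close>

lemma weighted_pair_sum_variance:
  assumes I: "{1..n + m} \<subseteq> I" and n: "n \<ge> 2" and m: "m \<ge> 2"
  defines "L \<equiv> (\<lambda>\<omega>. - (1 / real (n choose 2)) * (\<Sum>j=1..n. \<Sum>i=1..<j. H (W i \<omega>) (W j \<omega>))
      + 2 / (real n * real m) * (\<Sum>i=1..n. \<Sum>j=1..m. H (W i \<omega>) (W (n + j) \<omega>))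
      - (1 / real (m choose 2)) * (\<Sum>j=1..m. \<Sum>i=1..<j. H (W (n + i) \<omega>) (W (n + j) \<omega>)))"
  shows "S.variance L = c_coeff n m * V"
proof -
  define A where "A = (\<lambda>n::nat. {(i, j). 1 \<le> i \<and> i < j \<and> j \<le> n})"
  define P2 where "P2 = {1..n} \<times> {n + 1..n + m}"
  define P3 where "P3 = (\<lambda>(i, j). (n + i, n + j)) ` A m"
  let ?P = "A n \<union> P2 \<union> P3"
  let ?h = "\<lambda>\<omega> (s, t). H (W s \<omega>) (W t \<omega>)"
  \<comment> \<open>A pair \<open>s < t\<close> lies within the first sample iff \<open>t \<le> n\<close> and is mixed iff \<open>s \<le> n < t\<close>.\<close>
  define c where "c = (\<lambda>s t. if t \<le> n then - (1 / real (n choose 2))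
     else if s \<le> n then 2 / (real n * real m) else - (1 / real (m choose 2)))"
  have fin: "finite (A n)" "finite P2" "finite P3"
  proof -
    have "finite (A i)" for i unfolding A_def by (rule finite_ordered_pairs)
    then show "finite (A n)" "finite P2" "finite P3" by (auto simp: P2_def P3_def)
  qed
  have disj: "A n \<inter> P2 = {}" "(A n \<union> P2) \<inter> P3 = {}"
    by (auto simp: A_def P2_def P3_def)
  have card_A: "real (card (A i)) = real i * (real i - 1) / 2" for i
    unfolding A_def by (rule card_ordered_pairs)
  have inj: "inj_on (\<lambda>(i, j). (n + i, n + j)) (A m)" by (auto intro!: inj_onI)
  have P: "finite ?P" "?P \<subseteq> I \<times> I" "\<And>s t. (s, t) \<in> ?P \<Longrightarrow> s \<noteq> t"
    "\<And>s t u v. (s, t) \<in> ?P \<Longrightarrow> (u, v) \<in> ?P \<Longrightarrow> {s, t} = {u, v} \<Longrightarrow> (s, t) = (u, v)"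
  proof -
    have lt: "s < t \<and> s \<in> {1..n + m} \<and> t \<in> {1..n + m}" if "(s, t) \<in> ?P" for s t
      using that by (auto simp: A_def P2_def P3_def)
    show "finite ?P" using fin by simp
    show "?P \<subseteq> I \<times> I"
    proof (rule subrelI)
      fix s t assume "(s, t) \<in> ?P"
      then show "(s, t) \<in> I \<times> I" using lt[of s t] I by auto
    qed
    show "\<And>s t. (s, t) \<in> ?P \<Longrightarrow> s \<noteq> t" using lt by blast
    show "\<And>s t u v. (s, t) \<in> ?P \<Longrightarrow> (u, v) \<in> ?P \<Longrightarrow> {s, t} = {u, v} \<Longrightarrow> (s, t) = (u, v)"
      using lt by (metis doubleton_eq_iff order_less_asym)
  qed
  have split: "(\<Sum>(s, t)\<in>?P. c s t * f s t)
      = - (1 / real (n choose 2)) * (\<Sum>(s, t)\<in>A n. f s t)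
        + 2 / (real n * real m) * (\<Sum>(s, t)\<in>P2. f s t)
        - (1 / real (m choose 2)) * (\<Sum>(s, t)\<in>P3. f s t)" for f :: "nat \<Rightarrow> nat \<Rightarrow> real"
  proof -
    have "(\<Sum>(s, t)\<in>?P. c s t * f s t)
        = (\<Sum>(s, t)\<in>A n. c s t * f s t) + (\<Sum>(s, t)\<in>P2. c s t * f s t) + (\<Sum>(s, t)\<in>P3. c s t * f s t)"
      using fin disj by (simp add: sum.union_disjoint)
    also have "(\<Sum>(s, t)\<in>A n. c s t * f s t) = (\<Sum>(s, t)\<in>A n. - (1 / real (n choose 2)) * f s t)"
      by (rule sum.cong) (auto simp: A_def c_def)
    also have "(\<Sum>(s, t)\<in>P2. c s t * f s t) = (\<Sum>(s, t)\<in>P2. 2 / (real n * real m) * f s t)"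
      by (rule sum.cong) (auto simp: P2_def c_def)
    also have "(\<Sum>(s, t)\<in>P3. c s t * f s t) = (\<Sum>(s, t)\<in>P3. - (1 / real (m choose 2)) * f s t)"
      by (rule sum.cong) (auto simp: A_def P3_def c_def)
    finally show ?thesis by (simp add: case_prod_beta sum_distrib_left[symmetric] sum_negf sum_divide_distrib[symmetric])
  qed
  have L: "L \<omega> = (\<Sum>(s, t)\<in>?P. c s t * H (W s \<omega>) (W t \<omega>))" for \<omega>
  proof -
    have 1: "(\<Sum>j=1..n. \<Sum>i=1..<j. H (W i \<omega>) (W j \<omega>)) = (\<Sum>(s, t)\<in>A n. H (W s \<omega>) (W t \<omega>))"
      unfolding A_def by (rule sum_ordered_pairs)
    have 2: "(\<Sum>i=1..n. \<Sum>j=1..m. H (W i \<omega>) (W (n + j) \<omega>)) = (\<Sum>(s, t)\<in>P2. H (W s \<omega>) (W t \<omega>))"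
      unfolding P2_def sum.cartesian_product
      by (rule sum.reindex_bij_witness[of _ "\<lambda>(i, j). (i, j - n)" "\<lambda>(i, j). (i, n + j)"]) auto
    have 3: "(\<Sum>j=1..m. \<Sum>i=1..<j. H (W (n + i) \<omega>) (W (n + j) \<omega>)) = (\<Sum>(s, t)\<in>P3. H (W s \<omega>) (W t \<omega>))"
      unfolding P3_def sum.reindex[OF inj] unfolding A_def sum_ordered_pairs
      by (rule sum.cong) auto
    show ?thesis unfolding L_def 1 2 3 split ..
  qed
  have L_sq: "integrable M (\<lambda>\<omega>. (L \<omega>)\<^sup>2)" "(\<integral>\<omega>. (L \<omega>)\<^sup>2 \<partial>M) = V * (\<Sum>(s, t)\<in>?P. (c s t)\<^sup>2)"
    using orthogonal_sum_second_moment[OF P, of c] by (simp_all only: L)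
  have L_mean: "integrable M L" "(\<integral>\<omega>. L \<omega> \<partial>M) = 0"
  proof -
    have E: "integrable M (\<lambda>\<omega>. H (W s \<omega>) (W t \<omega>))" "(\<integral>\<omega>. H (W s \<omega>) (W t \<omega>) \<partial>M) = 0"
      if st: "(s, t) \<in> ?P" for s t
    proof -
      have st': "s \<in> I" "t \<in> I" "s \<noteq> t" using st P(2,3) by auto
      have [measurable]: "W s \<in> measurable M \<mu>" "W t \<in> measurable M \<mu>" using st' by auto
      show int: "integrable M (\<lambda>\<omega>. H (W s \<omega>) (W t \<omega>))"
        by (rule S.square_integrable_imp_integrable[OF _ H_pair(1)[OF st']]) measurable
      show "(\<integral>\<omega>. H (W s \<omega>) (W t \<omega>) \<partial>M) = 0"
        using H_orthogonal[of s t "{}" "\<lambda>_. 1"] st' int by simp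
    qed
    show "integrable M L"
      unfolding L case_prod_beta using E by (intro Bochner_Integration.integrable_sum integrable_mult_right) auto
    have "(\<integral>\<omega>. L \<omega> \<partial>M) = (\<Sum>p\<in>?P. \<integral>\<omega>. c (fst p) (snd p) * H (W (fst p) \<omega>) (W (snd p) \<omega>) \<partial>M)"
      unfolding L case_prod_beta using E by (intro Bochner_Integration.integral_sum integrable_mult_right) auto
    also have "\<dots> = 0" by (rule sum.neutral) (use E in auto)
    finally show "(\<integral>\<omega>. L \<omega> \<partial>M) = 0" .
  qed
  have "(\<Sum>(s, t)\<in>?P. (c s t)\<^sup>2) = (\<Sum>(s, t)\<in>?P. c s t * c s t)" by (simp add: power2_eq_square)
  also have "\<dots> = - (1 / real (n choose 2)) * (\<Sum>(s, t)\<in>A n. c s t)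
        + 2 / (real n * real m) * (\<Sum>(s, t)\<in>P2. c s t)
        - (1 / real (m choose 2)) * (\<Sum>(s, t)\<in>P3. c s t)" by (rule split)
  also have "(\<Sum>(s, t)\<in>A n. c s t) = (\<Sum>(s, t)\<in>A n. - (1 / real (n choose 2)))"
    by (rule sum.cong) (auto simp: A_def c_def)
  also have "\<dots> = real n * (real n - 1) / 2 * - (1 / real (n choose 2))"
    by (simp add: case_prod_beta card_A)
  also have "(\<Sum>(s, t)\<in>P2. c s t) = (\<Sum>(s, t)\<in>P2. 2 / (real n * real m))"
    by (rule sum.cong) (auto simp: P2_def c_def)
  also have "\<dots> = real n * real m * (2 / (real n * real m))"
    by (simp add: case_prod_beta P2_def card_cartesian_product)
  also have "(\<Sum>(s, t)\<in>P3. c s t) = (\<Sum>(s, t)\<in>P3. - (1 / real (m choose 2)))"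
    by (rule sum.cong) (auto simp: A_def P3_def c_def)
  also have "\<dots> = real m * (real m - 1) / 2 * - (1 / real (m choose 2))"
    using card_image[OF inj] by (simp add: case_prod_beta P3_def card_A)
  also have "- (1 / real (n choose 2)) * (real n * (real n - 1) / 2 * - (1 / real (n choose 2)))
      + 2 / (real n * real m) * (real n * real m * (2 / (real n * real m)))
      - (1 / real (m choose 2)) * (real m * (real m - 1) / 2 * - (1 / real (m choose 2)))
      = c_coeff n m"
    using n m by (simp add: real_choose_2 c_coeff_def)
  finally show ?thesis using L_mean L_sq by (simp add: S.variance_eq)
qed

text \<open>The projected kernels are identified with multiples of \<open>H\<close> at pairs of points \<open>x\<close> for which
  \<open>k x\<close> is integrable. The finitely many sample points have this property almost surely, and the variance
  does not see the exceptional set.\<close>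

lemma L_stat_variance:
  assumes I: "{1..n + m} \<subseteq> I" and n: "n \<ge> 2" and m: "m \<ge> 2"
    and X: "\<And>i. i \<in> {1..n} \<Longrightarrow> Xs i = W i" and Y: "\<And>j. j \<in> {1..m} \<Longrightarrow> Ys j = W (n + j)"
  shows "S.variance (L_stat M k n m Xs Ys) = c_coeff n m * V"
proof -
  have Xm[measurable]: "Xs i \<in> measurable M \<mu>" if "i \<in> {1..n}" for i
  proof -
    have "i \<in> I" using that I by auto
    from W_measurable[OF this] show ?thesis by (simp only: X[OF that])
  qed
  have Ym[measurable]: "Ys j \<in> measurable M \<mu>" if "j \<in> {1..m}" for j
  proof -
    have "n + j \<in> I" using that I by auto
    from W_measurable[OF this] show ?thesis by (simp only: Y[OF that])
  qed
  have ix: "1 \<in> {1..n}" "2 \<in> {1..n}" "1 \<in> {1..m}" "2 \<in> {1..m}" using n m by auto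
  have idx: "1 \<in> I" "2 \<in> I" "n + 1 \<in> I" "n + 2 \<in> I" "2 \<noteq> n + 2"
    "n + 1 \<noteq> n + 2" "(1::nat) \<noteq> 2" using n m I by auto
  have h_eq: "h20 M k Ys x y = - H x y" "h02 M k Xs x y = - H x y" "h11 M k Xs Ys x y = H x y / 2"
    if "x \<in> space \<mu>" "y \<in> space \<mu>" "integrable \<mu> (k x)" "integrable \<mu> (k y)" for x y
  proof -
    have [measurable]: "k x \<in> borel_measurable \<mu>" "k y \<in> borel_measurable \<mu>"
      using that by auto
    have sec: "(\<lambda>z. k (fst z) y) \<in> borel_measurable (\<mu> \<Otimes>\<^sub>M \<mu>)" "(\<lambda>z. k (snd z) y) \<in> borel_measurable (\<mu> \<Otimes>\<^sub>M \<mu>)"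
      "(\<lambda>z. k (fst z) x) \<in> borel_measurable (\<mu> \<Otimes>\<^sub>M \<mu>)" "(\<lambda>z. k (snd z) x) \<in> borel_measurable (\<mu> \<Otimes>\<^sub>M \<mu>)"
      using that(1,2) by (auto intro!: k_measurable')
    have meas: "(\<lambda>z. h_core k x y (fst z) (snd z)) \<in> borel_measurable (\<mu> \<Otimes>\<^sub>M \<mu>)"
      "(\<lambda>z. h_core k (fst z) (snd z) x y) \<in> borel_measurable (\<mu> \<Otimes>\<^sub>M \<mu>)"
      "(\<lambda>z. h_core k x (fst z) y (snd z)) \<in> borel_measurable (\<mu> \<Otimes>\<^sub>M \<mu>)"
      unfolding h_core_def using sec by measurable
    show "h20 M k Ys x y = - H x y"
      using expectation_pair(2)[OF idx(3,4,6) meas(1)] integral_h_core(1)[OF that]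
      by (simp only: fst_conv snd_conv h20_def Y[OF ix(3)] Y[OF ix(4)])
    show "h02 M k Xs x y = - H x y"
      using expectation_pair(2)[OF idx(1,2,7) meas(2)] integral_h_core(2)[OF that]
      by (simp only: fst_conv snd_conv h02_def X[OF ix(1)] X[OF ix(2)])
    show "h11 M k Xs Ys x y = H x y / 2"
      using expectation_pair(2)[OF idx(2,4,5) meas(3)] integral_h_core(3)[OF that]
      by (simp only: fst_conv snd_conv h11_def X[OF ix(2)] Y[OF ix(4)])
  qed
  define L where "L = (\<lambda>\<omega>. - (1 / real (n choose 2)) * (\<Sum>j=1..n. \<Sum>i=1..<j. H (W i \<omega>) (W j \<omega>))
      + 2 / (real n * real m) * (\<Sum>i=1..n. \<Sum>j=1..m. H (W i \<omega>) (W (n + j) \<omega>))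
      - (1 / real (m choose 2)) * (\<Sum>j=1..m. \<Sum>i=1..<j. H (W (n + i) \<omega>) (W (n + j) \<omega>)))"
  have "AE \<omega> in M. \<forall>i\<in>{1..n + m}. integrable \<mu> (k (W i \<omega>))"
    using AE_W[OF AE_k_integrable] I by (intro AE_finite_allI) auto
  with AE_space have AE_L: "AE \<omega> in M. L_stat M k n m Xs Ys \<omega> = L \<omega>"
  proof eventually_elim
    case (elim \<omega>)
    have good: "W i \<omega> \<in> space \<mu>" "integrable \<mu> (k (W i \<omega>))" if "i \<in> {1..n + m}" for i
      using that elim I measurable_space[OF W_measurable] by blast+
    have 1: "(\<Sum>j=1..n. \<Sum>i=1..<j. h20 M k Ys (Xs i \<omega>) (Xs j \<omega>)) = (\<Sum>j=1..n. \<Sum>i=1..<j. - H (W i \<omega>) (W j \<omega>))"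
      by (intro sum.cong refl) (auto simp: X intro!: h_eq good)
    have 2: "(\<Sum>i=1..n. \<Sum>j=1..m. h11 M k Xs Ys (Xs i \<omega>) (Ys j \<omega>))
        = (\<Sum>i=1..n. \<Sum>j=1..m. H (W i \<omega>) (W (n + j) \<omega>) / 2)"
      by (intro sum.cong refl, simp only: X Y) (rule h_eq(3); rule good; auto)
    have 3: "(\<Sum>j=1..m. \<Sum>i=1..<j. h02 M k Xs (Ys i \<omega>) (Ys j \<omega>))
        = (\<Sum>j=1..m. \<Sum>i=1..<j. - H (W (n + i) \<omega>) (W (n + j) \<omega>))"
      by (intro sum.cong refl) (auto simp: Y intro!: h_eq good)
    show ?case
      unfolding L_stat_def L_def 1 2 3 by (simp add: sum_negf sum_divide_distrib[symmetric])
  qed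
  have h_meas: "(\<lambda>\<omega>. h20 M k Ys (Xs i \<omega>) (Xs j \<omega>)) \<in> borel_measurable M"
    if "i \<in> {1..n}" "j \<in> {1..n}" for i j
    unfolding h20_def h_core_def using that Xm Ym[OF ix(3)] Ym[OF ix(4)] by measurable
  have h_meas': "(\<lambda>\<omega>. h02 M k Xs (Ys i \<omega>) (Ys j \<omega>)) \<in> borel_measurable M"
    if "i \<in> {1..m}" "j \<in> {1..m}" for i j
    unfolding h02_def h_core_def using that Ym Xm[OF ix(1)] Xm[OF ix(2)] by measurable
  have h_meas'': "(\<lambda>\<omega>. h11 M k Xs Ys (Xs i \<omega>) (Ys j \<omega>)) \<in> borel_measurable M"
    if "i \<in> {1..n}" "j \<in> {1..m}" for i j
    unfolding h11_def h_core_def using that Xm Ym ix by measurable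
  have [measurable]: "L_stat M k n m Xs Ys \<in> borel_measurable M"
    unfolding L_stat_def[abs_def]
    by (intro borel_measurable_add borel_measurable_times borel_measurable_const borel_measurable_sum
        h_meas h_meas' h_meas'') auto
  have [measurable]: "L \<in> borel_measurable M"
    unfolding L_def
    by (intro borel_measurable_add borel_measurable_diff borel_measurable_times borel_measurable_const
        borel_measurable_sum H_measurable W_measurable) (use I in auto)
  have mean_eq: "(\<integral>\<omega>. L_stat M k n m Xs Ys \<omega> \<partial>M) = (\<integral>\<omega>. L \<omega> \<partial>M)"
    by (intro integral_cong_AE AE_L) measurable
  have "S.variance (L_stat M k n m Xs Ys) = S.variance L"
    unfolding mean_eq by (intro integral_cong_AE) (use AE_L in auto)
  then show ?thesis
    using weighted_pair_sum_variance[OF I n m] unfolding L_def by simp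
qed

end

section \<open>The two-sample problem under the null hypothesis\<close>

text \<open>With exponent \<open>q = 2 + 2 \<tau> \<le> 4\<close> and \<open>b\<close> the mean of the kernel, this makes the moment of
  order \<open>2 + 2 \<tau>\<close> finite when the fourth moment is.\<close>

lemma powr_le_fourth_powers:
  fixes a b q :: real
  assumes "0 \<le> q" "q \<le> 4"
  shows "\<bar>a - b\<bar> powr q \<le> 1 + 16 * (a ^ 4 + b ^ 4)"
proof (cases "\<bar>a - b\<bar> \<le> 1")
  case True
  then have "\<bar>a - b\<bar> powr q \<le> 1" using assms by (intro powr_le1) auto
  also have "1 \<le> 1 + 16 * (a ^ 4 + b ^ 4)" by simp
  finally show ?thesis .
next
  case False
  define c where "c = max \<bar>a\<bar> \<bar>b\<bar>"
  have "\<bar>a - b\<bar> powr q \<le> \<bar>a - b\<bar> powr 4" using assms False by (intro powr_mono) auto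
  also have "\<dots> = \<bar>a - b\<bar> ^ 4" using False by (simp add: powr_numeral)
  also have "\<dots> \<le> (2 * c) ^ 4" by (intro power_mono) (auto simp: c_def)
  also have "\<dots> = 16 * c ^ 4" by (simp add: power_mult_distrib)
  also have "c ^ 4 \<le> a ^ 4 + b ^ 4" by (auto simp: c_def max_def)
  finally show ?thesis by simp
qed

lemma mixture_of_equal_laws:
  assumes M: "prob_space M" and "X \<in> measurable M S" "Y \<in> measurable M S" "Z \<in> measurable M S"
    and mix: "mixture_of M S \<rho> X Y Z" and eq: "distr M S X = distr M S Y"
  shows "distr M S Z = distr M S X"
proof -
  interpret prob_space M by fact
  interpret X: prob_space "distr M S X" by (rule prob_space_distr) fact
  interpret Z: prob_space "distr M S Z" by (rule prob_space_distr) fact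
  show ?thesis
  proof (rule measure_eqI)
    fix A assume "A \<in> sets (distr M S Z)"
    then have "measure (distr M S Z) A = measure (distr M S X) A"
      using mix eq by (simp add: mixture_of_def algebra_simps)
    then show "emeasure (distr M S Z) A = emeasure (distr M S X) A"
      by (simp add: X.emeasure_eq_measure Z.emeasure_eq_measure)
  qed simp
qed

text \<open>Under the null hypothesis all variables have the law of \<open>X\<close>, the mixture \<open>Z\<close> included. Hence the
  pooled sample and the sequence \<open>Zs\<close> are two i.i.d. samples from one law \<open>\<mu>\<close>: the moments of the
  kernel are read off \<open>Zs\<close> as integrals over \<open>\<mu> \<Otimes>\<^sub>M \<mu>\<close>, and the statistics are functions of the
  pooled sample. The law \<open>\<mu>\<close> itself also serves as the measurable space of the points.\<close>

locale two_sample_null = prob_space M for M :: "'a measure" +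
  fixes S :: "'b measure" and k :: "'b \<Rightarrow> 'b \<Rightarrow> real" and a0 \<rho> :: real
    and X Y Z :: "'a \<Rightarrow> 'b" and Xs Ys Zs :: "nat \<Rightarrow> 'a \<Rightarrow> 'b"
  assumes XYZ[measurable]: "X \<in> measurable M S" "Y \<in> measurable M S" "Z \<in> measurable M S"
    and samples: "independent_samples M S X Y Xs Ys"
    and mixture: "mixture_of M S \<rho> X Y Z"
    and Zs: "iid_copies M S Z Zs"
    and null: "distr M S X = distr M S Y"
    and k_meas: "case_prod k \<in> borel_measurable (S \<Otimes>\<^sub>M S)"
    and k_symmetric: "\<And>x y. x \<in> space S \<Longrightarrow> y \<in> space S \<Longrightarrow> k x y = k y x"
    and k_diag: "\<And>x. x \<in> space S \<Longrightarrow> k x x = a0"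
    and moment4: "integrable M (\<lambda>\<omega>. (k (Zs 1 \<omega>) (Zs 2 \<omega>)) ^ 4)"
begin

definition \<mu> where "\<mu> = distr M S X"

lemma \<mu>_simps[simp]: "sets \<mu> = sets S" "space \<mu> = space S"
  by (simp_all add: \<mu>_def)

lemma change_target: "distr M \<mu> f = distr M S f"
  by (rule distr_cong) simp_all

definition W :: "nat \<Rightarrow> nat \<Rightarrow> 'a \<Rightarrow> 'b" where
  "W n s \<omega> = pooled n (\<lambda>i. Xs i \<omega>) (\<lambda>j. Ys j \<omega>) s"

lemma k_meas_\<mu>: "(\<lambda>z. k (fst z) (snd z)) \<in> borel_measurable (\<mu> \<Otimes>\<^sub>M \<mu>)"
proof -
  have "sets (\<mu> \<Otimes>\<^sub>M \<mu>) = sets (S \<Otimes>\<^sub>M S)" by (intro sets_pair_measure_cong) simp_all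
  then have "measurable (\<mu> \<Otimes>\<^sub>M \<mu>) borel = measurable (S \<Otimes>\<^sub>M S) (borel :: real measure)"
    by (rule measurable_cong_sets) simp
  with k_meas show ?thesis by (simp add: case_prod_beta')
qed

lemma Zs_indep: "indep_vars (\<lambda>_. \<mu>) Zs {1..}"
  and Zs_law: "i \<ge> 1 \<Longrightarrow> distr M \<mu> (Zs i) = \<mu>"
proof -
  have Z: "distr M S Z = \<mu>"
    unfolding \<mu>_def by (rule mixture_of_equal_laws) (use mixture null prob_space_axioms in auto)
  have "indep_vars (\<lambda>_. S) Zs {1..}" using Zs by (simp add: iid_copies_def)
  from indep_vars_cong_sets[OF this, of \<mu>] show "indep_vars (\<lambda>_. \<mu>) Zs {1..}" by simp
  show "distr M \<mu> (Zs i) = \<mu>" if "i \<ge> 1"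
    using Zs that by (simp add: change_target iid_copies_def Z)
qed

lemma moment4_\<mu>: "integrable (\<mu> \<Otimes>\<^sub>M \<mu>) (\<lambda>z. (k (fst z) (snd z)) ^ 4)"
proof -
  have [measurable]: "Zs 1 \<in> measurable M \<mu>" "Zs 2 \<in> measurable M \<mu>"
    using Zs_indep by (auto simp: indep_vars_def)
  have "distr M (\<mu> \<Otimes>\<^sub>M \<mu>) (\<lambda>\<omega>. (Zs 1 \<omega>, Zs 2 \<omega>)) = \<mu> \<Otimes>\<^sub>M \<mu>"
    using indep_vars_pair_distr[OF Zs_indep, of 1 2] Zs_law[of 1] Zs_law[of 2] by simp
  moreover have "(\<lambda>\<omega>. (Zs 1 \<omega>, Zs 2 \<omega>)) \<in> measurable M (\<mu> \<Otimes>\<^sub>M \<mu>)" by measurable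
  note integrable_distr_eq[OF this, of "\<lambda>z. (k (fst z) (snd z)) ^ 4"]
  ultimately show ?thesis using moment4 k_meas_\<mu> by simp
qed

sublocale K: pair_kernel \<mu> k
proof -
  interpret \<mu>: prob_space \<mu> unfolding \<mu>_def by (rule prob_space_distr) simp
  interpret pair: pair_prob_space \<mu> \<mu> ..
  have "integrable (\<mu> \<Otimes>\<^sub>M \<mu>) (\<lambda>z. (k (fst z) (snd z))\<^sup>2)"
    by (rule pair.square_integrable_imp_integrable)
       (use moment4_\<mu> k_meas_\<mu> in \<open>auto simp: power_mult[symmetric]\<close>)
  then show "pair_kernel \<mu> k"
    by unfold_locales (use k_meas_\<mu> k_symmetric in auto)
qed

sublocale Z: iid_sample \<mu> k M Zs "{1..}"
  by unfold_locales (use Zs_indep Zs_law in auto)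

lemma pooled_iid: "iid_sample \<mu> k M (W n) {1..}"
proof
  define f :: "nat \<Rightarrow> nat + nat" where "f = (\<lambda>s. if s \<le> n then Inl s else Inr (s - n))"
  have W: "W n s = case_sum Xs Ys (f s)" for s by (auto simp: W_def pooled_def f_def fun_eq_iff)
  have "indep_vars (\<lambda>_. S) (\<lambda>s. case_sum Xs Ys (f s)) {1..}"
    by (rule indep_vars_reindex_inj[where I = "{1..} <+> {1..}"])
       (use samples in \<open>auto simp: independent_samples_def f_def inj_on_def split: if_splits\<close>)
  then have "indep_vars (\<lambda>_. S) (W n) {1..}" by (simp add: W[abs_def])
  from indep_vars_cong_sets[OF this, of \<mu>] show "indep_vars (\<lambda>_. \<mu>) (W n) {1..}" by simp
  show "distr M \<mu> (W n i) = \<mu>" if "i \<in> {1..}" for i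
    unfolding change_target using that samples null
    by (auto simp: W f_def independent_samples_def iid_copies_def \<mu>_def)
qed

lemma V2_eq: "V2 M k Zs = K.V"
  by (rule Z.V2_eq_V) auto

lemma variance_L_stat:
  assumes "n \<ge> 2" "m \<ge> 2"
  shows "variance (L_stat M k n m Xs Ys) = c_coeff n m * V2 M k Zs"
proof -
  interpret P: iid_sample \<mu> k M "W n" "{1..}" by (rule pooled_iid)
  show ?thesis
    unfolding V2_eq by (rule P.L_stat_variance) (use assms in \<open>auto simp: W_def[abs_def] pooled_def\<close>)
qed

lemma V_star_deviation:
  assumes N: "n + m \<ge> 5" and V: "V2 M k Zs > 0" and \<tau>: "0 < \<tau>" "\<tau> \<le> 1"
    and \<epsilon>: "\<epsilon> > 0" "2 / (real (n + m) - 3) \<le> \<epsilon> / 3"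
  shows "prob {\<omega> \<in> space M. \<bar>V_star k a0 n m Xs Ys \<omega> / V2 M k Zs - 1\<bar> > \<epsilon>}
    \<le> (1152 / \<epsilon>\<^sup>2 + 24 / \<epsilon>) * (3 powr (3 + 2 * \<tau>)
        * ((\<integral>\<omega>. \<bar>k_centered M k Zs \<omega>\<bar> powr (2 + 2 * \<tau>) \<partial>M)
          / (real (n + m) powr \<tau> * V2 M k Zs powr (1 + \<tau>))))
      + 9 * real (n + m) / (\<epsilon> * ((real (n + m) - 2) * (real (n + m) - 3)))"
proof -
  interpret P: iid_sample \<mu> k M "W n" "{1..}" by (rule pooled_iid)
  have mean: "(\<integral>\<omega>. k (Zs 1 \<omega>) (Zs 2 \<omega>) \<partial>M) = K.mean"
    using Z.k_pair(3)[of 1 2] by simp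
  let ?f = "\<lambda>z. \<bar>k (fst z) (snd z) - K.mean\<bar> powr (2 + 2 * \<tau>)"
  have f_meas: "?f \<in> borel_measurable (\<mu> \<Otimes>\<^sub>M \<mu>)" by measurable
  have mom: "integrable (\<mu> \<Otimes>\<^sub>M \<mu>) ?f"
  proof (rule Bochner_Integration.integrable_bound[OF _ f_meas])
    show "integrable (\<mu> \<Otimes>\<^sub>M \<mu>) (\<lambda>z. 1 + 16 * ((k (fst z) (snd z)) ^ 4 + K.mean ^ 4))"
      using moment4_\<mu> by simp
    show "AE z in \<mu> \<Otimes>\<^sub>M \<mu>. norm (?f z) \<le> norm (1 + 16 * ((k (fst z) (snd z)) ^ 4 + K.mean ^ 4))"
    proof (rule AE_I2)
      fix z
      have "?f z \<le> 1 + 16 * ((k (fst z) (snd z)) ^ 4 + K.mean ^ 4)"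
        by (rule powr_le_fourth_powers) (use \<tau> in auto)
      then show "norm (?f z) \<le> norm (1 + 16 * ((k (fst z) (snd z)) ^ 4 + K.mean ^ 4))" by simp
    qed
  qed
  have E: "(\<integral>z. ?f z \<partial>(\<mu> \<Otimes>\<^sub>M \<mu>)) = (\<integral>\<omega>. \<bar>k_centered M k Zs \<omega>\<bar> powr (2 + 2 * \<tau>) \<partial>M)"
    using Z.expectation_pair(2)[of 1 2, OF _ _ _ f_meas] mean by (simp add: k_centered_def)
  have V_star: "V_star k a0 n m Xs Ys \<omega> = 1 / (real (n + m) * (real (n + m) - 3))
        * (\<Sum>s=1..n + m. \<Sum>t\<in>{1..n + m} - {s}. (A_star (n + m) (\<lambda>s t. k (W n s \<omega>) (W n t \<omega>)) s t)\<^sup>2)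
      - a0\<^sup>2 / ((real (n + m) - 1) * (real (n + m) - 3))" for \<omega>
    by (simp add: V_star_def Let_def W_def)
  show ?thesis
    unfolding V_star V2_eq E[symmetric]
    by (rule P.estimator_deviation[OF _ N _ _ \<tau> \<epsilon> mom]) (use V k_diag in \<open>auto simp: V2_eq\<close>)
qed

end

theorem proposition14:
  fixes M :: "nat \<Rightarrow> 'a measure"
    and k :: "nat \<Rightarrow> point \<Rightarrow> point \<Rightarrow> real"
    and a0 :: "nat \<Rightarrow> real"
    and X Y Z :: "nat \<Rightarrow> 'a \<Rightarrow> point"
    and Xs Ys Zs :: "nat \<Rightarrow> nat \<Rightarrow> 'a \<Rightarrow> point"
    and n m p :: "nat \<Rightarrow> nat"
    and \<rho> \<tau> :: real
  assumes prob_space: "\<And>d. d \<ge> 1 \<Longrightarrow> prob_space (M d)"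
    and kernel: "\<And>d. d \<ge> 1 \<Longrightarrow> is_kernel d (k d)"
    and diag: "\<And>d x. d \<ge> 1 \<Longrightarrow> x \<in> space (Rp d) \<Longrightarrow> k d x x = a0 d"
    and X: "\<And>d. d \<ge> 1 \<Longrightarrow> X d \<in> measurable (M d) (Rp d)"
    and Y: "\<And>d. d \<ge> 1 \<Longrightarrow> Y d \<in> measurable (M d) (Rp d)"
    and Z: "\<And>d. d \<ge> 1 \<Longrightarrow> Z d \<in> measurable (M d) (Rp d)"
    and samples: "\<And>d. d \<ge> 1 \<Longrightarrow> independent_samples (M d) (Rp d) (X d) (Y d) (Xs d) (Ys d)"
    and mixture: "\<And>d. d \<ge> 1 \<Longrightarrow> mixture_of (M d) (Rp d) \<rho> (X d) (Y d) (Z d)"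
    and Zs: "\<And>d. d \<ge> 1 \<Longrightarrow> iid_copies (M d) (Rp d) (Z d) (Zs d)"
    and moment4: "\<And>d. d \<ge> 1 \<Longrightarrow> integrable (M d) (\<lambda>\<omega>. (k d (Zs d 1 \<omega>) (Zs d 2 \<omega>)) ^ 4)"
    and null: "\<And>d. d \<ge> 1 \<Longrightarrow> distr (M d) (Rp d) (X d) = distr (M d) (Rp d) (Y d)"
    and rho: "0 < \<rho>" "\<rho> < 1"
    and n: "filterlim n at_top sequentially"
    and m: "filterlim m at_top sequentially"
    and p: "filterlim p at_top sequentially"
    and ratio: "(\<lambda>l. real (n l) / real (n l + m l)) \<longlonglongrightarrow> \<rho>"
    and tau: "0 < \<tau>" "\<tau> \<le> 1"
    and V2_pos: "eventually (\<lambda>l. V2 (M (p l)) (k (p l)) (Zs (p l)) > 0) sequentially"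
    and moment_cond:
      "(\<lambda>l. (\<integral>\<omega>. \<bar>k_centered (M (p l)) (k (p l)) (Zs (p l)) \<omega>\<bar> powr (2 + 2 * \<tau>) \<partial>M (p l))
            / (real (n l + m l) powr \<tau> * V2 (M (p l)) (k (p l)) (Zs (p l)) powr (1 + \<tau>)))
       \<longlonglongrightarrow> 0"
  shows "conv_in_prob (\<lambda>l. M (p l))
           (\<lambda>l \<omega>. V_star (k (p l)) (a0 (p l)) (n l) (m l) (Xs (p l)) (Ys (p l)) \<omega>
                 / V2 (M (p l)) (k (p l)) (Zs (p l))) 1 \<and>
         conv_in_prob (\<lambda>l. M (p l))
           (\<lambda>l \<omega>. c_coeff (n l) (m l)
                   * V_star (k (p l)) (a0 (p l)) (n l) (m l) (Xs (p l)) (Ys (p l)) \<omega>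
                 / prob_space.variance (M (p l))
                     (L_stat (M (p l)) (k (p l)) (n l) (m l) (Xs (p l)) (Ys (p l)))) 1"
proof -
  define N where "N = (\<lambda>l. n l + m l)"
  let ?V = "\<lambda>l. V2 (M (p l)) (k (p l)) (Zs (p l))"
  let ?U = "\<lambda>l \<omega>. V_star (k (p l)) (a0 (p l)) (n l) (m l) (Xs (p l)) (Ys (p l)) \<omega>"
  have null_model: "two_sample_null (M d) (Rp d) (k d) (a0 d) \<rho> (X d) (Y d) (Z d) (Xs d) (Ys d) (Zs d)"
    if "d \<ge> 1" for d
  proof -
    interpret prob_space "M d" by (rule prob_space[OF that])
    show ?thesis
      by unfold_locales
        (use X Y Z samples mixture Zs null kernel diag moment4 that in \<open>auto simp: is_kernel_def\<close>)
  qed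
  have N_top: "filterlim (\<lambda>l. real (N l)) at_top sequentially"
    unfolding N_def
    by (rule filterlim_compose[OF filterlim_real_sequentially])
       (rule filterlim_at_top_mono[OF n], simp)
  have ev: "\<forall>\<^sub>F l in sequentially. p l \<ge> 1 \<and> n l \<ge> 3 \<and> m l \<ge> 3 \<and> ?V l > 0"
    using n m p V2_pos by (auto simp: filterlim_at_top eventually_conj_iff)
  define cond where "cond = (\<lambda>l. (\<integral>\<omega>. \<bar>k_centered (M (p l)) (k (p l)) (Zs (p l)) \<omega>\<bar> powr (2 + 2 * \<tau>) \<partial>M (p l))
            / (real (N l) powr \<tau> * ?V l powr (1 + \<tau>)))"
  have cond: "cond \<longlonglongrightarrow> 0" using moment_cond by (simp add: cond_def N_def)
  have conv: "conv_in_prob (\<lambda>l. M (p l)) (\<lambda>l \<omega>. ?U l \<omega> / ?V l) 1"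
    unfolding conv_in_prob_def
  proof (intro allI impI)
    fix \<epsilon> :: real assume \<epsilon>: "\<epsilon> > 0"
    \<comment> \<open>The finite-sample deviation bound at \<open>l\<close>: the moment ratio controls the average of \<open>H\<^sup>2\<close>, and
      the second term the row sums and the total.\<close>
    define bound where "bound = (\<lambda>l. (1152 / \<epsilon>\<^sup>2 + 24 / \<epsilon>) * (3 powr (3 + 2 * \<tau>) * cond l)
      + 9 / \<epsilon> * (real (N l) / ((real (N l) - 2) * (real (N l) - 3))))"
    have "((\<lambda>x::real. x / ((x - 2) * (x - 3))) \<longlongrightarrow> 0) at_top" by real_asymp
    from filterlim_compose[OF this N_top]
    have "(\<lambda>l. real (N l) / ((real (N l) - 2) * (real (N l) - 3))) \<longlonglongrightarrow> 0" .
    then have "bound \<longlonglongrightarrow> (1152 / \<epsilon>\<^sup>2 + 24 / \<epsilon>) * (3 powr (3 + 2 * \<tau>) * 0) + 9 / \<epsilon> * 0"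
      unfolding bound_def by (intro tendsto_intros cond)
    then have bound: "bound \<longlonglongrightarrow> 0" by simp
    have "((\<lambda>x::real. 2 / (x - 3)) \<longlongrightarrow> 0) at_top" by real_asymp
    from filterlim_compose[OF this N_top]
    have "\<forall>\<^sub>F l in sequentially. 2 / (real (N l) - 3) < \<epsilon> / 3"
      using \<epsilon> by (intro order_tendstoD(2)) auto
    with ev have "\<forall>\<^sub>F l in sequentially.
        measure (M (p l)) {\<omega> \<in> space (M (p l)). \<bar>?U l \<omega> / ?V l - 1\<bar> > \<epsilon>} \<le> bound l"
    proof eventually_elim
      case (elim l)
      interpret two_sample_null "M (p l)" "Rp (p l)" "k (p l)" "a0 (p l)" \<rho> "X (p l)" "Y (p l)" "Z (p l)"
        "Xs (p l)" "Ys (p l)" "Zs (p l)"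
        using elim by (intro null_model) simp
      show ?case
        using V_star_deviation[of "n l" "m l" \<tau> \<epsilon>] elim tau \<epsilon>
        by (simp add: bound_def cond_def N_def)
    qed
    then show "(\<lambda>l. measure (M (p l)) {\<omega> \<in> space (M (p l)). \<bar>?U l \<omega> / ?V l - 1\<bar> > \<epsilon>}) \<longlonglongrightarrow> 0"
      by (rule tendsto_sandwich[OF _ _ tendsto_const bound, rotated]) simp
  qed
  have ratio_eq: "\<forall>\<^sub>F l in sequentially. \<forall>\<omega>. c_coeff (n l) (m l) * ?U l \<omega>
      / prob_space.variance (M (p l)) (L_stat (M (p l)) (k (p l)) (n l) (m l) (Xs (p l)) (Ys (p l)))
      = ?U l \<omega> / ?V l"
    using ev
  proof eventually_elim
    case (elim l)
    interpret two_sample_null "M (p l)" "Rp (p l)" "k (p l)" "a0 (p l)" \<rho> "X (p l)" "Y (p l)" "Z (p l)"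
      "Xs (p l)" "Ys (p l)" "Zs (p l)"
      using elim by (intro null_model) simp
    have "c_coeff (n l) (m l) > 0"
      using elim unfolding c_coeff_def by (intro add_pos_pos divide_pos_pos mult_pos_pos) auto
    then show ?case using variance_L_stat[of "n l" "m l"] elim by simp
  qed
  have "conv_in_prob (\<lambda>l. M (p l))
           (\<lambda>l \<omega>. c_coeff (n l) (m l) * ?U l \<omega>
                 / prob_space.variance (M (p l))
                     (L_stat (M (p l)) (k (p l)) (n l) (m l) (Xs (p l)) (Ys (p l)))) 1"
    unfolding conv_in_prob_def
  proof (intro allI impI)
    fix \<epsilon> :: real assume "\<epsilon> > 0"
    with conv have "(\<lambda>l. measure (M (p l)) {\<omega> \<in> space (M (p l)). \<bar>?U l \<omega> / ?V l - 1\<bar> > \<epsilon>}) \<longlonglongrightarrow> 0"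
      by (simp add: conv_in_prob_def)
    then show "(\<lambda>l. measure (M (p l)) {\<omega> \<in> space (M (p l)). \<bar>c_coeff (n l) (m l) * ?U l \<omega>
        / prob_space.variance (M (p l)) (L_stat (M (p l)) (k (p l)) (n l) (m l) (Xs (p l)) (Ys (p l)))
        - 1\<bar> > \<epsilon>}) \<longlonglongrightarrow> 0"
      by (rule Lim_transform_eventually) (use ratio_eq in eventually_elim, simp)
  qed
  with conv show ?thesis by simp
qed

end
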